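(* For $k\in\mathbb{R}$ and $s\in\mathbb{C}$ let $W_1(k;s)$ be as defined in the context. Then for all $s \in \mathbb{C}$ the following hold. (i) If $|k|>2$, then $$W_1(k;s) = |k|^s \cdot {}_{2} F_{1} \left( \tfrac{-s}{2}, \tfrac{1-s}{2} ; 1; \tfrac{4}{k^2} \right).$$ (ii) If $|k|=2$, then $$W_1(k;s) = \frac{2^s \Gamma(\frac{1}{2} + s)}{\Gamma(1+\frac{s}{2}) \Gamma(\frac{1+s}{2})}.$$ (iii) If $|k|<2$, then $$W_{1}(k;s) = \frac{4^s \Gamma(\frac{1 + s}{2})^2}{\pi \Gamma(1 + s)} \cdot {}_{2} F_{1} \left( \tfrac{-s}{2}, \tfrac{-s}{2} ; \tfrac{1}{2}; \tfrac{k^2}{4} \right).$$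
   Context: For $r\ge 1$, real $k$ and complex $s$, the zeta Mahler function is $$W_r(k;s) = \frac{1}{(2 \pi i)^r} \int_{\mathbb{T}^r} \left|k + (x_1 + x_1^{-1}) \cdots (x_r + x_r^{-1}) \right|^s \frac{dx_1}{x_1} \cdots \frac{dx_r}{x_r},$$ where $\mathbb{T}^r=\{(x_1,\dots,x_r)\in\mathbb{C}^r : |x_1|=\dots=|x_r|=1\}$; it is defined by this integral in a half-plane $\operatorname{Re}(s)>s_0$ where the integral converges, and extended in $s$ by meromorphic continuation. Here ${}_{p+1}F_p(a_1,\dots,a_{p+1};b_1,\dots,b_p;z)=\sum_{n\ge0}\frac{(a_1)_n\cdots(a_{p+1})_n}{(b_1)_n\cdots(b_p)_n}\frac{z^n}{n!}$ with $(x)_n=x(x+1)\cdots(x+n-1)$. *)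

theory Defs
  imports "HOL-Complex_Analysis.Complex_Analysis"
begin

(* Integration over the torus in coordinates 1..r: the r-dimensional analogue of the
   contour integral along circlepath 0 1. The Lebesgue integral is used, so
   convergence means absolute convergence. *)

definition torus_pullback ::
    "nat \<Rightarrow> ((nat \<Rightarrow> complex) \<Rightarrow> complex) \<Rightarrow> (nat \<Rightarrow> real) \<Rightarrow> complex" where
  "torus_pullback r F t =
     F (\<lambda>j. circlepath 0 1 (t j)) *
     (\<Prod>j = 1..r. vector_derivative (circlepath 0 1) (at (t j)))"

definition torus_integrable :: "nat \<Rightarrow> ((nat \<Rightarrow> complex) \<Rightarrow> complex) \<Rightarrow> bool" where
  "torus_integrable r F \<longleftrightarrow>
     set_integrable (PiM {1..r} (\<lambda>_. lborel)) (PiE {1..r} (\<lambda>_. {0..1})) (torus_pullback r F)"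

definition torus_integral :: "nat \<Rightarrow> ((nat \<Rightarrow> complex) \<Rightarrow> complex) \<Rightarrow> complex" where
  "torus_integral r F =
     set_lebesgue_integral (PiM {1..r} (\<lambda>_. lborel)) (PiE {1..r} (\<lambda>_. {0..1})) (torus_pullback r F)"

definition zeta_mahler_integrand ::
    "nat \<Rightarrow> real \<Rightarrow> complex \<Rightarrow> (nat \<Rightarrow> complex) \<Rightarrow> complex" where
  "zeta_mahler_integrand r k s x =
     of_real (cmod (of_real k + (\<Prod>j = 1..r. x j + inverse (x j)))) powr s / (\<Prod>j = 1..r. x j)"

(* The meromorphic continuation to the whole plane of the integral, given on some half-plane
   on which it converges. By the identity theorem there is at most one such f, because
   nicely_meromorphic_on removes removable singularities and fixes the value 0 at poles
   (the same convention as for Gamma in the library). *)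

definition is_zeta_mahler :: "nat \<Rightarrow> real \<Rightarrow> (complex \<Rightarrow> complex) \<Rightarrow> bool" where
  "is_zeta_mahler r k f \<longleftrightarrow>
     f nicely_meromorphic_on UNIV \<and>
     (\<exists>s0::real. \<forall>s. Re s > s0 \<longrightarrow>
        torus_integrable r (zeta_mahler_integrand r k s) \<and>
        f s = 1 / (2 * of_real pi * \<i>) ^ r * torus_integral r (zeta_mahler_integrand r k s))"

definition zeta_mahler :: "nat \<Rightarrow> real \<Rightarrow> complex \<Rightarrow> complex" where
  "zeta_mahler r k = (THE f. is_zeta_mahler r k f)"

definition hypergeometric :: "complex list \<Rightarrow> complex list \<Rightarrow> complex \<Rightarrow> complex" where
  "hypergeometric as bs z = eval_fps (fps_hypergeo as bs 1) z"

end

theory Submission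
  imports Defs
begin

text \<open>
  On the half-plane \<open>Re s > 1\<close> the torus integral equals the mean of \<open>\<bar>k + 2 cos (pi t)\<bar>\<^sup>s\<close> over
  \<open>0 \<le> t \<le> 1\<close>, and a nicely meromorphic function is determined by its values there. It thus suffices to
  compute this mean, and, as it is holomorphic in \<open>s\<close>, to do so for large real \<open>s\<close>.

  If \<open>\<bar>k\<bar> > 2\<close>, expand the power by the binomial series and integrate the powers of the cosine.
  If \<open>\<bar>k\<bar> = 2\<close>, the half-angle formula gives a Beta integral. If \<open>\<bar>k\<bar> < 2\<close>, the mean \<open>F k\<close> satisfies
  \<open>(4 - k\<^sup>2) F'' + (2 s - 1) k F' - s\<^sup>2 F = 0\<close> and is even in \<open>k\<close>. The function \<open>2F1 (-s/2, -s/2; 1/2; k\<^sup>2/4)\<close>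
  has the same two properties and, for real \<open>s\<close>, nonnegative Taylor coefficients, hence no zeros on the
  interval, so the Wronskian shows that \<open>F\<close> is \<open>F 0\<close> times it; \<open>F 0\<close> is again a Beta integral.
\<close>

section \<open>Averages over the cosine\<close>

text \<open>The claim covers every \<open>s\<close>, poles included, so each closed form must be
  nicely meromorphic, with value 0 at its poles. Where Gamma functions occur, the candidate is
  therefore written as one Gamma factor times an entire function that does not vanish at the poles
  of that factor. For \<open>|k| < 2\<close> this nonvanishing comes from the same positivity that
  lets the Wronskian argument divide: the poles are real, and the two upper parameters of the
  hypergeometric function coincide, so for real \<open>s\<close> its coefficients are squares over
  positive numbers.

  The bound \<open>s > 2\<close> allows two derivatives in \<open>k\<close> under the integral
  although \<open>k + 2 cos (pi t)\<close> changes sign. The equation degenerates at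
  \<open>k = 2\<close> and \<open>k = -2\<close>, which confines the comparison to the open interval
  between them. Evenness singles out one solution up to a factor, as it forces the derivative 0 at
  \<open>k = 0\<close>.\<close>

lemma has_integral_reflect_interval:
  fixes f :: "real \<Rightarrow> 'a::euclidean_space"
  assumes "(f has_integral I) {a..b}"
  shows "((\<lambda>t. f (c - t)) has_integral I) {c - b..c - a}"
proof -
  have "((\<lambda>t. f (1 *\<^sub>R t + c)) has_integral (I /\<^sub>R 1 ^ DIM(real)))
           (cbox ((a - c) /\<^sub>R 1) ((b - c) /\<^sub>R 1))"
    by (rule has_integral_affinity') (use assms in auto)
  then have "((\<lambda>t. f (t + c)) has_integral I) {- (c - a)..- (c - b)}"
    by simp
  from has_integral_reflect_real[THEN iffD2, OF this] show ?thesis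
    by simp
qed

lemma integral_reflect_interval:
  fixes f :: "real \<Rightarrow> 'a::euclidean_space"
  assumes "continuous_on {a..b} f"
  shows "integral {c - b..c - a} (\<lambda>t. f (c - t)) = integral {a..b} f"
  using has_integral_reflect_interval[OF integrable_integral[OF integrable_continuous_real[OF assms]]]
  by (rule integral_unique)

lemma integral_symmetric_double:
  fixes f :: "real \<Rightarrow> 'a::euclidean_space"
  assumes f: "continuous_on {0..1} f" and sym: "\<And>t. t \<in> {0..1/2} \<Longrightarrow> f (1 - t) = f t"
  shows "integral {0..1} f = 2 *\<^sub>R integral {0..1/2} f"
proof -
  have "integral {0..1} f = integral {0..1/2} f + integral {1/2..1} f"
    by (rule Henstock_Kurzweil_Integration.integral_combine[symmetric]) (use f in \<open>auto intro: integrable_continuous_real\<close>)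
  also have "integral {1/2..1} f = integral {1 - 1..1 - 1/2} (\<lambda>t. f (1 - t))"
    by (rule integral_reflect_interval[symmetric]) (use f in \<open>auto intro: continuous_on_subset\<close>)
  also have "\<dots> = integral {0..1/2} f"
    by (simp, rule integral_cong, use sym in auto)
  finally show ?thesis
    by (simp add: scaleR_2)
qed

lemma continuous_on_cos_compose:
  fixes f :: "real \<Rightarrow> 'a::topological_space"
  assumes "continuous_on {-1..1} f"
  shows "continuous_on A (\<lambda>t. f (cos (c * t)))"
proof (rule continuous_on_compose2[OF assms])
  show "continuous_on A (\<lambda>t. cos (c * t))"
    by (intro continuous_intros)
qed auto

text \<open>Around the circle the cosine runs through its values twice. The reflection
  \<open>t -> 1 - t\<close> identifies the two halves of the period, and rescaling one half gives
  back the unit interval.\<close>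

lemma integral_cos_full_period:
  fixes f :: "real \<Rightarrow> 'a::euclidean_space"
  assumes f: "continuous_on {-1..1} f"
  shows "integral {0..1} (\<lambda>t. f (cos (2 * pi * t))) = integral {0..1} (\<lambda>t. f (cos (pi * t)))"
proof -
  have "integral {0..1} (\<lambda>t. f (cos (2 * pi * t))) =
          2 *\<^sub>R integral {0..1/2} (\<lambda>t. f (cos (2 * pi * t)))"
    by (rule integral_symmetric_double)
      (auto intro: continuous_on_cos_compose[OF f] simp: right_diff_distrib cos_diff)
  also have "integral {0..1/2} (\<lambda>t. f (cos (2 * pi * t))) =
               (1/2) *\<^sub>R integral {0..1} (\<lambda>t. f (cos (pi * t)))"
  proof (rule integral_unique)
    have "((\<lambda>t. f (cos (pi * t))) has_integral integral {0..1} (\<lambda>t. f (cos (pi * t)))) {0..1}"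
      by (intro integrable_integral integrable_continuous_real continuous_on_cos_compose[OF f])
    then have "((\<lambda>t. f (cos (pi * t))) has_integral integral {0..1} (\<lambda>t. f (cos (pi * t)))) (cbox 0 1)"
      by simp
    from has_integral_affinity'[OF this, of 2 0]
    show "((\<lambda>t. f (cos (2 * pi * t))) has_integral (1/2) *\<^sub>R integral {0..1} (\<lambda>t. f (cos (pi * t)))) {0..1/2}"
      by (simp add: mult_ac)
  qed
  finally show ?thesis
    by simp
qed

text \<open>The reflection \<open>t -> 1 - t\<close> changes the sign of \<open>cos (pi t)\<close>.
  This is the source of the parity facts below: evenness in \<open>k\<close>, the vanishing
  derivative at \<open>k = 0\<close>, and the vanishing odd powers.\<close>

lemma integral_cos_uminus:
  fixes f :: "real \<Rightarrow> 'a::euclidean_space"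
  assumes f: "continuous_on {-1..1} f"
  shows "integral {0..1} (\<lambda>t. f (- cos (pi * t))) = integral {0..1} (\<lambda>t. f (cos (pi * t)))"
  using integral_reflect_interval[OF continuous_on_cos_compose[OF f, of "{0..1}" pi], of 1]
  by (simp add: right_diff_distrib cos_diff)

text \<open>The substitution \<open>u = cos (pi t) ^ 2\<close> turns a Beta integral into this one.
  It is carried out on open intervals, where sine and cosine are positive and the map is injective;
  the end points have measure zero.\<close>

lemma has_integral_cos_powr:
  assumes s: "s > -1"
  shows "((\<lambda>t. cos (pi * t) powr s) has_integral Beta ((s + 1) / 2) (1/2) / (2 * pi)) {0..1/2}"
proof -
  \<comment> \<open>The Beta integrand, with \<open>1 / (2 * pi)\<close> to absorb the constant in
    the Jacobian \<open>g'\<close>.\<close>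
  define f :: "real \<Rightarrow> real"
    where "f u = 1 / (2 * pi) * (u powr ((s + 1) / 2 - 1) * (1 - u) powr (1/2 - 1))" for u
  define g where "g t = (cos (pi * t))\<^sup>2" for t :: real
  define g' where "g' t = - 2 * pi * (cos (pi * t) * sin (pi * t))" for t :: real
  have cs: "cos (pi * t) > 0" "sin (pi * t) > 0" if "t \<in> {0<..<1/2}" for t :: real
  proof -
    have "0 < pi * t" "pi * t < pi / 2"
      using that by auto
    then show "cos (pi * t) > 0" "sin (pi * t) > 0"
      by (auto intro!: cos_gt_zero sin_gt_zero)
  qed
  have img: "g ` {0<..<1/2} = {0<..<1}"
  proof (intro equalityI subsetI)
    fix u assume "u \<in> g ` {0<..<1/2}"
    then obtain t where t: "t \<in> {0<..<1/2}" "u = g t" by auto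
    then have "u = 1 - (sin (pi * t))\<^sup>2"
      by (simp add: g_def cos_squared_eq)
    moreover have "0 < (sin (pi * t))\<^sup>2" "0 < (cos (pi * t))\<^sup>2"
      using cs[OF t(1)] by auto
    ultimately have "0 < u" "u < 1"
      using t(2) unfolding g_def by linarith+
    then show "u \<in> {0<..<1}" by auto
  next
    fix u :: real assume u: "u \<in> {0<..<1}"
    define t where "t = arccos (sqrt u) / pi"
    have su: "0 < sqrt u" "sqrt u < 1" using u by auto
    have "arccos (sqrt u) < pi / 2" "0 < arccos (sqrt u)"
      using arccos_less_arccos[of 0 "sqrt u"] arccos_less_arccos[of "sqrt u" 1] su by auto
    then have "t \<in> {0<..<1/2}"
      by (auto simp: t_def divide_less_eq)
    moreover have "g t = u"
      using u cos_arccos[of "sqrt u"] su by (simp add: g_def t_def del: real_sqrt_lt_1_iff real_sqrt_gt_0_iff)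
    ultimately show "u \<in> g ` {0<..<1/2}" by blast
  qed
  have inj: "inj_on g {0<..<1/2}"
  proof (rule inj_onI)
    fix x y assume xy: "x \<in> {0<..<1/2}" "y \<in> {0<..<1/2}" "g x = g y"
    then have "cos (pi * x) = cos (pi * y)"
      using cs[OF xy(1)] cs[OF xy(2)] unfolding g_def by (simp add: power2_eq_iff)
    moreover have "pi * x \<in> {0..pi}" "pi * y \<in> {0..pi}"
      using xy by (auto simp: mult_le_cancel_left1)
    ultimately have "pi * x = pi * y"
      by (metis arccos_cos atLeastAtMost_iff)
    then show "x = y" by simp
  qed
  have deriv: "(g has_real_derivative g' t) (at t within {0<..<1/2})" for t
    unfolding g_def g'_def by (auto intro!: derivative_eq_intros simp: power2_eq_square)
  have f: "(f has_integral Beta ((s + 1) / 2) (1/2) / (2 * pi)) {0..1}"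
    using has_integral_mult_right[OF has_integral_Beta_real[of "(s + 1) / 2" "1/2"], of "1 / (2 * pi)"] s
    unfolding f_def by simp
  then have f': "(f has_integral Beta ((s + 1) / 2) (1/2) / (2 * pi)) {0<..<1}"
    by (simp add: has_integral_Icc_iff_Ioo)
  \<comment> \<open>The integrand is unbounded near 1; the absolute integrability that the change of
    variables asks for is taken from its sign.\<close>
  moreover have "f absolutely_integrable_on {0<..<1}"
    using f' by (intro nonnegative_absolutely_integrable_1) (auto simp: f_def has_integral_iff)
  ultimately have "(\<lambda>x. \<bar>g' x\<bar> * f (g x)) absolutely_integrable_on {0<..<1/2} \<and>
      integral {0<..<1/2} (\<lambda>x. \<bar>g' x\<bar> * f (g x)) = Beta ((s + 1) / 2) (1/2) / (2 * pi)"
    by (subst has_absolute_integral_change_of_variables_1'[OF _ deriv inj])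
      (auto simp: img has_integral_iff)
  then have "((\<lambda>x. \<bar>g' x\<bar> * f (g x)) has_integral Beta ((s + 1) / 2) (1/2) / (2 * pi)) {0<..<1/2}"
    by (auto simp: has_integral_iff absolutely_integrable_on_def)
  also have "?this \<longleftrightarrow> ((\<lambda>t. cos (pi * t) powr s) has_integral Beta ((s + 1) / 2) (1/2) / (2 * pi)) {0<..<1/2}"
  proof (rule has_integral_cong)
    fix t :: real assume t: "t \<in> {0<..<1/2}"
    define c d where "c = cos (pi * t)" and "d = sin (pi * t)"
    have cd: "c > 0" "d > 0" "1 - c\<^sup>2 = d\<^sup>2"
      using cs[OF t] by (auto simp: c_def d_def sin_squared_eq)
    have sq: "x\<^sup>2 powr a = x powr (2 * a)" if "x > 0" for x a :: real
      using that by (simp add: power2_eq_square powr_mult flip: powr_add)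
    have "c\<^sup>2 powr ((s + 1) / 2 - 1) = c powr (s - 1)"
      using cd by (simp add: sq diff_divide_distrib add_divide_distrib algebra_simps)
    moreover have "d\<^sup>2 powr (1/2 - 1) = d powr (- 1)"
      using cd by (simp add: sq)
    ultimately have "f (g t) = 1 / (2 * pi) * (c powr (s - 1) * d powr (- 1))"
      unfolding f_def g_def c_def[symmetric] cd(3) by simp
    moreover have "\<bar>g' t\<bar> = 2 * pi * (c * d)"
      using cd by (simp add: g'_def abs_mult flip: c_def d_def)
    ultimately have "\<bar>g' t\<bar> * f (g t) = c * c powr (s - 1)"
      using cd by (simp add: powr_minus)
    also have "\<dots> = c powr s"
      using cd by (simp add: powr_diff)
    finally show "\<bar>g' t\<bar> * f (g t) = cos (pi * t) powr s"
      by (simp add: c_def)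
  qed
  finally show ?thesis
    by (simp add: has_integral_Icc_iff_Ioo)
qed

section \<open>Moments of the shifted cosine and their differential equation\<close>

definition cos_moment :: "real \<Rightarrow> real \<Rightarrow> real" where
  "cos_moment s k = integral {0..1} (\<lambda>t. \<bar>k + 2 * cos (pi * t)\<bar> powr s)"

text \<open>Differentiation of \<open>|x| powr s\<close> alternates between even and odd powers, so
  up to a factor this is the first derivative in \<open>k\<close> of the even moment.\<close>

definition cos_sgn_moment :: "real \<Rightarrow> real \<Rightarrow> real" where
  "cos_sgn_moment s k =
     integral {0..1} (\<lambda>t. sgn (k + 2 * cos (pi * t)) * \<bar>k + 2 * cos (pi * t)\<bar> powr s)"

text \<open>The difference quotient is at most \<open>|h| powr (s - 1)\<close>, which tends to 0.
  This settles the origin, where \<open>sgn\<close> jumps and the power rule for a positive base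
  does not apply.\<close>

lemma DERIV_zero_of_abs_le_powr:
  fixes f :: "real \<Rightarrow> real"
  assumes s: "s > 1" and f: "\<And>x. \<bar>f x\<bar> \<le> \<bar>x\<bar> powr s"
  shows "(f has_real_derivative 0) (at 0)"
proof -
  have f0: "f 0 = 0" using f[of 0] by simp
  have "((\<lambda>h. f h / h) \<longlongrightarrow> 0) (at 0)"
  proof (rule Lim_null_comparison)
    show "eventually (\<lambda>h. norm (f h / h) \<le> \<bar>h\<bar> powr (s - 1)) (at 0)"
    proof (rule eventually_at_ball'[THEN eventually_mono, of 1])
      fix h :: real assume "h \<in> ball 0 1 \<and> h \<noteq> 0 \<and> h \<in> UNIV"
      then show "norm (f h / h) \<le> \<bar>h\<bar> powr (s - 1)"
        using f[of h] by (simp add: abs_divide powr_diff divide_right_mono)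
    qed simp
    have "((\<lambda>h::real. \<bar>h\<bar> powr (s - 1)) \<longlongrightarrow> \<bar>0\<bar> powr (s - 1)) (at 0)"
      by (rule tendsto_powr') (use s in \<open>auto intro!: tendsto_rabs_zero\<close>)
    then show "((\<lambda>h::real. \<bar>h\<bar> powr (s - 1)) \<longlongrightarrow> 0) (at 0)" by simp
  qed
  then show ?thesis
    by (simp add: DERIV_def f0)
qed

lemma eventually_sgn_eq:
  fixes x :: real
  assumes "x \<noteq> 0"
  shows "eventually (\<lambda>y. sgn y = sgn x) (nhds x)"
proof (cases "x > 0")
  case True
  have "eventually (\<lambda>y. y \<in> {0<..}) (nhds x)"
    by (rule eventually_nhds_in_open) (use True in auto)
  then show ?thesis by eventually_elim (use True in auto)
next
  case False
  have "eventually (\<lambda>y. y \<in> {..<0}) (nhds x)"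
    by (rule eventually_nhds_in_open) (use False assms in auto)
  then show ?thesis by eventually_elim (use False assms in auto)
qed

lemma DERIV_abs_powr:
  fixes x :: real
  assumes s: "s > 1"
  shows "((\<lambda>x. \<bar>x\<bar> powr s) has_real_derivative s * (sgn x * \<bar>x\<bar> powr (s - 1))) (at x)"
proof (cases "x = 0")
  case True
  then show ?thesis
    using DERIV_zero_of_abs_le_powr[OF s, of "\<lambda>x. \<bar>x\<bar> powr s"] by simp
next
  case False
  have "((\<lambda>x. \<bar>x\<bar> powr s) has_real_derivative s * \<bar>x\<bar> powr (s - 1) * sgn x) (at x)"
  proof -
    have "(abs has_real_derivative sgn x) (at x)"
    proof (rule DERIV_cong_ev[THEN iffD1])
      show "((\<lambda>y. sgn x * y) has_real_derivative sgn x) (at x)"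
        by (auto intro!: derivative_eq_intros)
      show "eventually (\<lambda>y. sgn x * y = \<bar>y\<bar>) (nhds x)"
        using eventually_sgn_eq[OF False] by eventually_elim (metis abs_sgn mult.commute)
    qed auto
    then show ?thesis
      by (rule DERIV_fun_powr[THEN DERIV_cong]) (use False in auto)
  qed
  then show ?thesis by (simp add: mult_ac)
qed

lemma DERIV_sgn_abs_powr:
  fixes x :: real
  assumes s: "s > 1"
  shows "((\<lambda>x. sgn x * \<bar>x\<bar> powr s) has_real_derivative s * \<bar>x\<bar> powr (s - 1)) (at x)"
proof (cases "x = 0")
  case True
  then show ?thesis
    using DERIV_zero_of_abs_le_powr[OF s, of "\<lambda>x. sgn x * \<bar>x\<bar> powr s"]
    by (simp add: abs_mult abs_sgn_eq)
next
  case False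
  have "((\<lambda>y. sgn x * \<bar>y\<bar> powr s) has_real_derivative s * \<bar>x\<bar> powr (s - 1)) (at x)"
    using DERIV_cmult[OF DERIV_abs_powr[OF s], of "sgn x" x] False
    by (simp add: mult_ac sgn_mult_self_eq)
  moreover have "eventually (\<lambda>y. sgn x * \<bar>y\<bar> powr s = sgn y * \<bar>y\<bar> powr s) (nhds x)"
    using eventually_sgn_eq[OF False] by eventually_elim simp
  ultimately show ?thesis
    using DERIV_cong_ev[of x x "\<lambda>y. sgn x * \<bar>y\<bar> powr s" "\<lambda>y. sgn y * \<bar>y\<bar> powr s"] by simp
qed

section \<open>Differentiation of the moments in the shift \<open>k\<close>\<close>

lemma continuous_on_abs_powr:
  fixes g :: "'a::topological_space \<Rightarrow> real"
  assumes "s > 0" "continuous_on A g"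
  shows "continuous_on A (\<lambda>x. \<bar>g x\<bar> powr s)"
  using assms by (intro continuous_on_powr') (auto intro!: continuous_intros)

lemma continuous_on_sgn_abs_powr:
  fixes g :: "'a::topological_space \<Rightarrow> real"
  assumes "s > 1" "continuous_on A g"
  shows "continuous_on A (\<lambda>x. sgn (g x) * \<bar>g x\<bar> powr s)"
proof (rule continuous_on_compose2[of UNIV _ A g])
  show "continuous_on UNIV (\<lambda>x::real. sgn x * \<bar>x\<bar> powr s)"
    by (rule DERIV_continuous_on[of _ _ "\<lambda>x. s * \<bar>x\<bar> powr (s - 1)"])
      (use DERIV_sgn_abs_powr[OF assms(1)] in auto)
qed (use assms in auto)

text \<open>Differentiation under the integral sign. With \<open>s > 2\<close> the differentiated
  integrand has exponent \<open>s - 1 > 1\<close>, the range in which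
  \<open>continuous_on_sgn_abs_powr\<close> supplies its joint continuity.\<close>

lemma DERIV_cos_moment:
  assumes s: "s > 2"
  shows "(cos_moment s has_real_derivative s * cos_sgn_moment (s - 1) k) (at k)"
proof -
  have "((\<lambda>k. integral (cbox 0 1) (\<lambda>t. \<bar>k + 2 * cos (pi * t)\<bar> powr s)) has_real_derivative
      integral (cbox 0 1) (\<lambda>t. s * (sgn (k + 2 * cos (pi * t)) * \<bar>k + 2 * cos (pi * t)\<bar> powr (s - 1))))
      (at k within UNIV)"
  proof (rule leibniz_rule_field_derivative)
    fix k t :: real
    show "((\<lambda>k. \<bar>k + 2 * cos (pi * t)\<bar> powr s) has_real_derivative
        s * (sgn (k + 2 * cos (pi * t)) * \<bar>k + 2 * cos (pi * t)\<bar> powr (s - 1))) (at k within UNIV)"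
    proof -
      have "((\<lambda>k. k + 2 * cos (pi * t)) has_real_derivative 1) (at k)"
        by (auto intro!: derivative_eq_intros)
      from DERIV_chain2[OF DERIV_abs_powr this] s show ?thesis by simp
    qed
  next
    fix k :: real
    show "(\<lambda>t. \<bar>k + 2 * cos (pi * t)\<bar> powr s) integrable_on cbox 0 1"
      by (intro integrable_continuous continuous_on_abs_powr) (use s in \<open>auto intro!: continuous_intros\<close>)
  next
    show "continuous_on (UNIV \<times> cbox 0 1) (\<lambda>(k, t::real). s * (sgn (k + 2 * cos (pi * t)) * \<bar>k + 2 * cos (pi * t)\<bar> powr (s - 1)))"
      unfolding case_prod_unfold
      by (intro continuous_on_mult_left continuous_on_sgn_abs_powr) (use s in \<open>auto intro!: continuous_intros\<close>)
  qed auto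
  then show ?thesis
    unfolding cos_moment_def[abs_def] cos_sgn_moment_def by simp
qed

lemma DERIV_cos_sgn_moment:
  assumes s: "s > 1"
  shows "(cos_sgn_moment s has_real_derivative s * cos_moment (s - 1) k) (at k)"
proof -
  have "((\<lambda>k. integral (cbox 0 1) (\<lambda>t. sgn (k + 2 * cos (pi * t)) * \<bar>k + 2 * cos (pi * t)\<bar> powr s))
      has_real_derivative integral (cbox 0 1) (\<lambda>t. s * \<bar>k + 2 * cos (pi * t)\<bar> powr (s - 1)))
      (at k within UNIV)"
  proof (rule leibniz_rule_field_derivative)
    fix k t :: real
    show "((\<lambda>k. sgn (k + 2 * cos (pi * t)) * \<bar>k + 2 * cos (pi * t)\<bar> powr s) has_real_derivative
        s * \<bar>k + 2 * cos (pi * t)\<bar> powr (s - 1)) (at k within UNIV)"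
    proof -
      have "((\<lambda>k. k + 2 * cos (pi * t)) has_real_derivative 1) (at k)"
        by (auto intro!: derivative_eq_intros)
      from DERIV_chain2[OF DERIV_sgn_abs_powr this] s show ?thesis by simp
    qed
  next
    fix k :: real
    show "(\<lambda>t. sgn (k + 2 * cos (pi * t)) * \<bar>k + 2 * cos (pi * t)\<bar> powr s) integrable_on cbox 0 1"
      by (intro integrable_continuous continuous_on_sgn_abs_powr) (use s in \<open>auto intro!: continuous_intros\<close>)
  next
    show "continuous_on (UNIV \<times> cbox 0 1) (\<lambda>(k, t::real). s * \<bar>k + 2 * cos (pi * t)\<bar> powr (s - 1))"
      unfolding case_prod_unfold
      by (intro continuous_on_mult_left continuous_on_abs_powr) (use s in \<open>auto intro!: continuous_intros\<close>)
  qed auto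
  then show ?thesis
    unfolding cos_moment_def cos_sgn_moment_def[abs_def] by simp
qed

text \<open>At \<open>k = 0\<close> the integrand is odd in the cosine. This is the initial
  condition that makes the Wronskian vanish at the origin.\<close>

lemma cos_sgn_moment_0:
  assumes s: "s > 1"
  shows "cos_sgn_moment s 0 = 0"
proof -
  define f :: "real \<Rightarrow> real" where "f c = sgn (2 * c) * \<bar>2 * c\<bar> powr s" for c
  have f: "continuous_on {-1..1} f"
    unfolding f_def by (intro continuous_on_sgn_abs_powr s continuous_intros)
  have "f (- c) = - f c" for c
    by (simp add: f_def sgn_if)
  with integral_cos_uminus[OF f] have "integral {0..1} (\<lambda>t. f (cos (pi * t))) = 0"
    by simp
  then show ?thesis
    by (simp add: cos_sgn_moment_def f_def)
qed

text \<open>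
  Obtained by integrating the derivative of \<open>sin (pi t) sgn w \<bar>w\<bar> powr (s - 1)\<close>, where
  \<open>w = k + 2 cos (pi t)\<close>: the boundary terms vanish, and \<open>cos\<close> and \<open>sin\<^sup>2\<close> are polynomials in \<open>w\<close>.
\<close>
lemma cos_moment_ode:
  assumes s: "s > 2"
  shows "s * cos_moment s k - k * (2 * s - 1) * cos_sgn_moment (s - 1) k
           - (s - 1) * (4 - k\<^sup>2) * cos_moment (s - 2) k = 0"
proof -
  define w where "w t = k + 2 * cos (pi * t)" for t :: real
  have cw: "continuous_on {0..1} w"
    unfolding w_def by (intro continuous_intros)
  have p: "((\<lambda>t. \<bar>w t\<bar> powr a) has_integral cos_moment a k) {0..1}" if "a > 0" for a
    unfolding cos_moment_def w_def[symmetric]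
    by (intro integrable_integral integrable_continuous_real continuous_on_abs_powr cw that)
  have q: "((\<lambda>t. sgn (w t) * \<bar>w t\<bar> powr a) has_integral cos_sgn_moment a k) {0..1}" if "a > 1" for a
    unfolding cos_sgn_moment_def w_def[symmetric]
    by (intro integrable_integral integrable_continuous_real continuous_on_sgn_abs_powr cw that)
  define U where "U t = sin (pi * t) * (sgn (w t) * \<bar>w t\<bar> powr (s - 1))" for t
  define U' where "U' t = pi * (cos (pi * t) * (sgn (w t) * \<bar>w t\<bar> powr (s - 1))
      - 2 * (s - 1) * (sin (pi * t))\<^sup>2 * \<bar>w t\<bar> powr (s - 2))" for t
  have dw: "(w has_real_derivative - 2 * pi * sin (pi * t)) (at t)" for t
    unfolding w_def by (auto intro!: derivative_eq_intros)
  have dU: "(U has_real_derivative U' t) (at t)" for t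
  proof -
    have "((\<lambda>t. sgn (w t) * \<bar>w t\<bar> powr (s - 1)) has_real_derivative
        (s - 1) * \<bar>w t\<bar> powr (s - 1 - 1) * (- 2 * pi * sin (pi * t))) (at t)"
      by (rule DERIV_chain2[OF DERIV_sgn_abs_powr dw]) (use s in auto)
    then have "(U has_real_derivative cos (pi * t) * pi * (sgn (w t) * \<bar>w t\<bar> powr (s - 1)) +
        (s - 1) * \<bar>w t\<bar> powr (s - 1 - 1) * (- 2 * pi * sin (pi * t)) * sin (pi * t)) (at t)"
      unfolding U_def by (rule DERIV_mult[rotated]) (auto intro!: derivative_eq_intros)
    then show ?thesis
      by (rule DERIV_cong) (simp add: U'_def power2_eq_square algebra_simps)
  qed
  have "(U' has_integral (U 1 - U 0)) {0..1}"
    by (rule fundamental_theorem_of_calculus)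
      (auto intro: has_field_derivative_at_within dU simp flip: has_real_derivative_iff_has_vector_derivative)
  \<comment> \<open>The factor \<open>2 / pi\<close> clears the inner derivative \<open>pi\<close>
    and the denominator in \<open>cos (pi t) = (w t - k) / 2\<close>.\<close>
  then have zero: "((\<lambda>t. 2 / pi * U' t) has_integral 0) {0..1}"
    using has_integral_mult_right[of U' 0 "{0..1}" "2 / pi"] by (simp add: U_def)
  have "((\<lambda>t. s * \<bar>w t\<bar> powr s - k * (2 * s - 1) * (sgn (w t) * \<bar>w t\<bar> powr (s - 1))
           - (s - 1) * (4 - k\<^sup>2) * \<bar>w t\<bar> powr (s - 2)) has_integral
      (s * cos_moment s k - k * (2 * s - 1) * cos_sgn_moment (s - 1) k
           - (s - 1) * (4 - k\<^sup>2) * cos_moment (s - 2) k)) {0..1}"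
    by (intro has_integral_diff has_integral_mult_right p q) (use s in auto)
  moreover have "s * \<bar>w t\<bar> powr s - k * (2 * s - 1) * (sgn (w t) * \<bar>w t\<bar> powr (s - 1))
           - (s - 1) * (4 - k\<^sup>2) * \<bar>w t\<bar> powr (s - 2) = 2 / pi * U' t" for t
  proof -
    \<comment> \<open>Every term is a polynomial in \<open>w t\<close> times \<open>P\<close>, so
      the claim becomes a polynomial identity. At a zero of \<open>w t\<close> all the terms in
      question are 0.\<close>
    define P where "P = \<bar>w t\<bar> powr (s - 2)"
    have 1: "sgn (w t) * \<bar>w t\<bar> powr (s - 1) = w t * P"
      by (cases "w t = 0") (auto simp: P_def powr_diff sgn_if power2_eq_square)
    have 2: "\<bar>w t\<bar> powr s = (w t)\<^sup>2 * P"
      by (cases "w t = 0") (auto simp: P_def powr_diff)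
    have 3: "cos (pi * t) = (w t - k) / 2"
      by (simp add: w_def)
    have 4: "(sin (pi * t))\<^sup>2 = 1 - ((w t - k) / 2)\<^sup>2"
      unfolding sin_squared_eq 3 ..
    show ?thesis
      unfolding U'_def 1 2 4 P_def[symmetric] unfolding 3
      by (simp add: field_simps power2_eq_square)
  qed
  ultimately have "((\<lambda>t. 2 / pi * U' t) has_integral
      (s * cos_moment s k - k * (2 * s - 1) * cos_sgn_moment (s - 1) k
           - (s - 1) * (4 - k\<^sup>2) * cos_moment (s - 2) k)) {0..1}"
    by (simp only:)
  then show ?thesis
    using zero by (rule has_integral_unique)
qed

section \<open>The hypergeometric function\<close>

text \<open>The coefficients of \<open>2F1 (R, R; c)\<close>. They bound those of
  \<open>2F1 (a, b; c)\<close> for all \<open>a\<close>, \<open>b\<close> of norm at most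
  \<open>R\<close>, hence uniformly in the parameters, and they never vanish, so the ratio test
  applies even where the series for \<open>a\<close>, \<open>b\<close> terminates.\<close>

definition majorant :: "real \<Rightarrow> real \<Rightarrow> nat \<Rightarrow> real" where
  "majorant R c n = (pochhammer R n)\<^sup>2 / (pochhammer c n * fact n)"

lemma majorant_pos: "R > 0 \<Longrightarrow> c > 0 \<Longrightarrow> majorant R c n > 0"
  unfolding majorant_def by (intro divide_pos_pos mult_pos_pos zero_less_power pochhammer_pos) auto

text \<open>The ratio of a term to its successor is \<open>(c + n) (1 + n) / (R + n) ^ 2\<close>, a
  product of two quotients that tend to 1.\<close>

lemma conv_radius_majorant:
  assumes "R > 0" "c > 0"
  shows "conv_radius (majorant R c) = 1"
proof (rule conv_radius_ratio_limit_nonzero[of _ 1])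
  have quot: "(\<lambda>n. (d + real n) / (R + real n)) \<longlonglongrightarrow> 1" for d
  proof -
    have "(\<lambda>n. 1 + (d - R) / (R + real n)) \<longlonglongrightarrow> 1 + 0"
      by (intro tendsto_add tendsto_const real_tendsto_divide_at_top[OF tendsto_const]
          filterlim_tendsto_add_at_top[OF tendsto_const] filterlim_real_sequentially)
    moreover have "1 + (d - R) / (R + real n) = (d + real n) / (R + real n)" for n
    proof -
      have "R + real n \<noteq> 0" using assms by linarith
      then show ?thesis by (simp add: divide_simps)
    qed
    ultimately show ?thesis by simp
  qed
  have "(\<lambda>n. (c + real n) * real (Suc n) / (R + real n)\<^sup>2) \<longlonglongrightarrow> 1"
    using tendsto_mult[OF quot[of c] quot[of 1]] by (simp add: power2_eq_square add.commute)
  moreover have "norm (majorant R c n) / norm (majorant R c (Suc n)) =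
      (c + real n) * real (Suc n) / (R + real n)\<^sup>2" for n
  proof -
    define m where "m = majorant R c n"
    have R: "R + real n > 0" and c: "c + real n > 0"
      using assms by linarith+
    have "majorant R c (Suc n) = m * ((R + real n)\<^sup>2 / ((c + real n) * real (Suc n)))"
      by (simp add: majorant_def m_def pochhammer_Suc power_mult_distrib mult_ac)
    moreover have "m > 0" "majorant R c (Suc n) > 0"
      unfolding m_def by (rule majorant_pos[OF assms])+
    ultimately show ?thesis
      using R c assms by (simp add: m_def[symmetric] abs_of_pos)
  qed
  ultimately show "(\<lambda>n. norm (majorant R c n) / norm (majorant R c (Suc n))) \<longlonglongrightarrow> 1"
    by simp
qed (auto simp: one_ereal_def)

lemma norm_pochhammer_le:
  fixes a :: "'a::real_normed_field"
  assumes "norm a \<le> R"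
  shows "norm (pochhammer a n) \<le> pochhammer R n"
  unfolding pochhammer_prod prod_norm[symmetric]
proof (intro prod_mono conjI norm_ge_zero)
  fix i
  have "norm (a + of_nat i) \<le> norm a + norm (of_nat i :: 'a)"
    by (rule norm_triangle_ineq)
  with assms show "norm (a + of_nat i) \<le> R + of_nat i" by simp
qed

lemma fps_hypergeo_2_1_nth:
  "fps_hypergeo [a, b] [c] 1 $ n = pochhammer a n * pochhammer b n / (pochhammer c n * fact n)"
  by simp

lemma norm_fps_hypergeo_le:
  fixes a b :: "'a::real_normed_field"
  assumes "norm a \<le> R" "norm b \<le> R" "c > 0"
  shows "norm (fps_hypergeo [a, b] [of_real c] 1 $ n) \<le> majorant R c n"
proof -
  have "norm (fps_hypergeo [a, b] [of_real c] 1 $ n) =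
      norm (pochhammer a n) * norm (pochhammer b n) / (pochhammer c n * fact n)"
    using pochhammer_pos[OF assms(3), of n]
    by (simp add: norm_mult norm_divide pochhammer_of_real)
  also have "\<dots> \<le> pochhammer R n * pochhammer R n / (pochhammer c n * fact n)"
    by (intro divide_right_mono mult_mono norm_pochhammer_le assms)
      (use pochhammer_pos[OF assms(3), of n]
        order_trans[OF norm_ge_zero norm_pochhammer_le[OF assms(1), of n]] in auto)
  finally show ?thesis
    by (simp add: majorant_def power2_eq_square)
qed

lemma fps_conv_radius_hypergeo:
  fixes a b :: "'a::{real_normed_field, banach}"
  assumes "c > 0"
  shows "fps_conv_radius (fps_hypergeo [a, b] [of_real c] 1) \<ge> 1"
proof -
  define R where "R = max 1 (max (norm a) (norm b))"
  have R: "R > 0" "norm a \<le> R" "norm b \<le> R"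
    by (auto simp: R_def)
  show ?thesis
    unfolding fps_conv_radius_def
  proof (rule conv_radius_geI_ex')
    fix r :: real assume r: "0 < r" "ereal r < 1"
    show "summable (\<lambda>n. fps_hypergeo [a, b] [of_real c] 1 $ n * of_real r ^ n)"
    proof (rule summable_comparison_test')
      show "summable (\<lambda>n. majorant R c n * r ^ n)"
        by (rule summable_in_conv_radius) (use r conv_radius_majorant[OF R(1) assms] in simp)
      show "norm (fps_hypergeo [a, b] [of_real c] 1 $ n * of_real r ^ n) \<le> majorant R c n * r ^ n" for n
        unfolding norm_mult norm_power norm_of_real using r
        by (intro mult_mono norm_fps_hypergeo_le R assms)
          (auto intro: less_imp_le majorant_pos R assms)
    qed
  qed
qed

text \<open>Lets results about the real series, such as its positivity, be used for the complex
  function at real parameters.\<close>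

lemma hypergeometric_of_real:
  fixes a b c z :: real
  assumes "c > 0" "\<bar>z\<bar> < 1"
  shows "hypergeometric [of_real a, of_real b] [of_real c] (of_real z) =
           of_real (eval_fps (fps_hypergeo [a, b] [c] 1) z)"
proof -
  have "ereal (norm z) < 1" using assms by simp
  also have "1 \<le> fps_conv_radius (fps_hypergeo [a, b] [c] 1)"
    using fps_conv_radius_hypergeo[OF assms(1), of a b] by simp
  finally have "(\<lambda>n. fps_hypergeo [a, b] [c] 1 $ n * z ^ n) sums eval_fps (fps_hypergeo [a, b] [c] 1) z"
    by (rule sums_eval_fps)
  then have "(\<lambda>n. complex_of_real (fps_hypergeo [a, b] [c] 1 $ n * z ^ n)) sums
      of_real (eval_fps (fps_hypergeo [a, b] [c] 1) z)"
    by (simp only: sums_of_real_iff)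
  also have "(\<lambda>n. complex_of_real (fps_hypergeo [a, b] [c] 1 $ n * z ^ n)) =
      (\<lambda>n. fps_hypergeo [of_real a, of_real b] [of_real c] 1 $ n * of_real z ^ n)"
    by (simp add: pochhammer_of_real)
  finally show ?thesis
    unfolding hypergeometric_def eval_fps_def by (simp only: sums_iff)
qed

text \<open>The partial sums are polynomials in \<open>a s\<close> and \<open>b s\<close>. On a ball
  where both are bounded by some \<open>R\<close>, the majorant makes them converge uniformly, so
  the limit is holomorphic in the parameter.\<close>

lemma hypergeometric_holomorphic:
  fixes a b :: "complex \<Rightarrow> complex"
  assumes a: "a holomorphic_on UNIV" and b: "b holomorphic_on UNIV" and c: "c > 0" and z: "norm z < 1"
  shows "(\<lambda>s. hypergeometric [a s, b s] [of_real c] z) holomorphic_on UNIV"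
proof (rule holomorphic_uniform_sequence[where f = "\<lambda>N s. \<Sum>n<N. fps_hypergeo [a s, b s] [of_real c] 1 $ n * z ^ n"])
  fix N
  have "pochhammer (of_real c :: complex) n \<noteq> 0" for n
    using pochhammer_pos[OF c, of n] by (simp add: pochhammer_of_real)
  then show "(\<lambda>s. \<Sum>n<N. fps_hypergeo [a s, b s] [of_real c] 1 $ n * z ^ n) holomorphic_on UNIV"
    unfolding fps_hypergeo_2_1_nth pochhammer_prod
    by (intro holomorphic_intros a b) auto
next
  fix s0 :: complex
  have ca: "compact (a ` cball s0 1)" "compact (b ` cball s0 1)"
    using a b by (auto intro!: compact_continuous_image holomorphic_on_imp_continuous_on
      intro: holomorphic_on_subset)
  then have "bounded (a ` cball s0 1 \<union> b ` cball s0 1)"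
    by (simp add: compact_imp_bounded)
  then obtain R where R: "R > 0" "\<And>x. x \<in> a ` cball s0 1 \<union> b ` cball s0 1 \<Longrightarrow> norm x \<le> R"
    unfolding bounded_pos by blast
  have "uniform_limit (cball s0 1) (\<lambda>N s. \<Sum>n<N. fps_hypergeo [a s, b s] [of_real c] 1 $ n * z ^ n)
      (\<lambda>s. \<Sum>n. fps_hypergeo [a s, b s] [of_real c] 1 $ n * z ^ n) sequentially"
  proof (rule Weierstrass_m_test)
    fix n s assume s: "s \<in> cball s0 1"
    show "norm (fps_hypergeo [a s, b s] [of_real c] 1 $ n * z ^ n) \<le> majorant R c n * norm z ^ n"
      unfolding norm_mult norm_power
      by (intro mult_right_mono norm_fps_hypergeo_le c R) (use s in auto)
  next
    have "ereal (norm (norm z)) < conv_radius (majorant R c)"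
      using z by (simp add: conv_radius_majorant[OF R(1) c])
    then show "summable (\<lambda>n. majorant R c n * norm z ^ n)"
      by (rule summable_in_conv_radius)
  qed
  then show "\<exists>d>0. cball s0 d \<subseteq> UNIV \<and>
      uniform_limit (cball s0 d) (\<lambda>N s. \<Sum>n<N. fps_hypergeo [a s, b s] [of_real c] 1 $ n * z ^ n)
      (\<lambda>s. hypergeometric [a s, b s] [of_real c] z) sequentially"
    unfolding hypergeometric_def eval_fps_def by (intro exI[of _ 1]) auto
qed auto

section \<open>Differential equation and positivity of the hypergeometric series\<close>

lemma fps_hypergeo_ode:
  fixes a b c :: real
  assumes "c > 0"
  defines "A \<equiv> fps_hypergeo [a, b] [c] 1"
  shows "fps_X * fps_deriv (fps_deriv A) - fps_X\<^sup>2 * fps_deriv (fps_deriv A) + fps_const c * fps_deriv A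
           - fps_const (a + b + 1) * (fps_X * fps_deriv A) - fps_const (a * b) * A = 0"
proof (rule fps_ext)
  fix n
  define h where "h = (\<lambda>n. A $ n)"
  \<comment> \<open>Compared coefficient by coefficient, the differential equation is this two-term
    recurrence; no convergence is involved yet.\<close>
  have rec: "h (Suc n) * (c + real n) * real (Suc n) = (a + real n) * (b + real n) * h n" for n
  proof -
    have "c + real n \<noteq> 0" using assms(1) by linarith
    then show ?thesis
      unfolding h_def A_def fps_hypergeo_rec by simp
  qed
  show "(fps_X * fps_deriv (fps_deriv A) - fps_X\<^sup>2 * fps_deriv (fps_deriv A) + fps_const c * fps_deriv A
           - fps_const (a + b + 1) * (fps_X * fps_deriv A) - fps_const (a * b) * A) $ n = 0 $ n"
  proof (cases n)
    case 0
    then show ?thesis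
      using rec[of 0] by (simp add: h_def power2_eq_square mult_ac)
  next
    case (Suc m)
    \<comment> \<open>Multiplication by the square of \<open>fps_X\<close> shifts by two and so
      contributes nothing at index 1, which is therefore a case of its own.\<close>
    have X2: "(fps_X\<^sup>2 * F) $ Suc m = (if m = 0 then 0 else F $ (m - 1))" for F :: "real fps"
      by (cases m) (simp_all add: power2_eq_square mult.assoc)
    have X2': "(F * fps_X\<^sup>2) $ Suc m = (if m = 0 then 0 else F $ (m - 1))" for F :: "real fps"
      by (subst mult.commute) (rule X2)
    show ?thesis
      using rec[of "Suc m"] X2 X2' unfolding Suc
      by (cases m) (simp_all add: algebra_simps flip: h_def)
  qed
qed

lemma eval_fps_hypergeo_ode:
  fixes a b c z :: real
  assumes c: "c > 0" and z: "\<bar>z\<bar> < 1"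
  defines "A \<equiv> fps_hypergeo [a, b] [c] 1"
  shows "z * (1 - z) * eval_fps (fps_deriv (fps_deriv A)) z
           + (c - (a + b + 1) * z) * eval_fps (fps_deriv A) z - a * b * eval_fps A z = 0"
proof -
  have 0: "1 \<le> fps_conv_radius A"
    unfolding A_def using fps_conv_radius_hypergeo[OF c, of a b] by simp
  have 1: "1 \<le> fps_conv_radius (fps_deriv A)"
    using 0 fps_conv_radius_deriv order_trans by blast
  have 2: "1 \<le> fps_conv_radius (fps_deriv (fps_deriv A))"
    using 1 fps_conv_radius_deriv order_trans by blast
  have m: "1 \<le> fps_conv_radius (f * g)" if "1 \<le> fps_conv_radius f" "1 \<le> fps_conv_radius g" for f g :: "real fps"
    using order_trans[OF _ fps_conv_radius_mult[of f g], of 1] that by auto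
  have d: "1 \<le> fps_conv_radius (f - g)" if "1 \<le> fps_conv_radius f" "1 \<le> fps_conv_radius g" for f g :: "real fps"
    using order_trans[OF _ fps_conv_radius_diff[of f g], of 1] that by auto
  have p: "1 \<le> fps_conv_radius (f + g)" if "1 \<le> fps_conv_radius f" "1 \<le> fps_conv_radius g" for f g :: "real fps"
    using order_trans[OF _ fps_conv_radius_add[of f g], of 1] that by auto
  have r: "ereal (norm z) < fps_conv_radius f" if "1 \<le> fps_conv_radius f" for f :: "real fps"
    using z by (intro less_le_trans[OF _ that]) simp
  have X: "1 \<le> fps_conv_radius (fps_X :: real fps)" "1 \<le> fps_conv_radius (fps_X ^ 2 :: real fps)"
    "1 \<le> fps_conv_radius (fps_const x :: real fps)" for x
    by simp_all
  note [simp] = eval_fps_mult[OF r r] eval_fps_diff[OF r r] eval_fps_add[OF r r] 0 1 2 m d p X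
  have "eval_fps (fps_X * fps_deriv (fps_deriv A) - fps_X\<^sup>2 * fps_deriv (fps_deriv A) + fps_const c * fps_deriv A
           - fps_const (a + b + 1) * (fps_X * fps_deriv A) - fps_const (a * b) * A) z = 0"
    unfolding A_def fps_hypergeo_ode[OF c] by simp
  then show ?thesis
    by (simp add: algebra_simps power2_eq_square del: fps_const_add fps_const_mult)
qed

text \<open>Equal upper parameters make each coefficient a square over a positive number, and the
  constant term is 1. Used both to divide by the series and to show that it cancels no pole of
  Gamma.\<close>

lemma eval_fps_hypergeo_square_pos:
  fixes a c z :: real
  assumes c: "c > 0" and z: "0 \<le> z" "z < 1"
  shows "eval_fps (fps_hypergeo [a, a] [c] 1) z > 0"
proof -
  let ?A = "fps_hypergeo [a, a] [c] 1"
  have "ereal (norm z) < 1" using z by simp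
  also have "1 \<le> fps_conv_radius ?A"
    using fps_conv_radius_hypergeo[OF c, of a a] by simp
  finally have s: "summable (\<lambda>n. ?A $ n * z ^ n)"
    by (rule summable_fps)
  have "0 \<le> ?A $ n * z ^ n" for n
    using z pochhammer_pos[OF c, of n] by (simp add: fps_hypergeo_2_1_nth)
  moreover have "?A $ 0 * z ^ 0 = 1" by simp
  ultimately show ?thesis
    unfolding eval_fps_def using suminf_pos2[OF s, of 0] by simp
qed

text \<open>\<open>W\<close> is the Wronskian of the moment and \<open>e0\<close>. Since both solve
  the same second-order equation, \<open>W\<close> solves a first-order one; it starts from 0
  because both derivatives vanish at the origin, hence stays 0. The constant quotient is read off at
  0, where \<open>e0\<close> is 1.\<close>

lemma cos_moment_eq_hypergeo:
  assumes s: "s > 2" and k: "\<bar>k\<bar> < 2"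
  shows "cos_moment s k = cos_moment s 0 * eval_fps (fps_hypergeo [- s / 2, - s / 2] [1/2] 1) (k\<^sup>2 / 4)"
proof -
  define A where "A = fps_hypergeo [- s / 2, - s / 2] [1/2] 1"
  define e0 where "e0 x = eval_fps A (x\<^sup>2 / 4)" for x
  define e1 where "e1 x = eval_fps (fps_deriv A) (x\<^sup>2 / 4)" for x
  define e2 where "e2 x = eval_fps (fps_deriv (fps_deriv A)) (x\<^sup>2 / 4)" for x
  define g1 where "g1 x = e1 x * (x / 2)" for x
  define f1 where "f1 x = s * cos_sgn_moment (s - 1) x" for x
  define f2 where "f2 x = s * ((s - 1) * cos_moment (s - 2) x)" for x
  have in_range: "x\<^sup>2 < 4" if "x \<in> {-2<..<2}" for x :: real
    using abs_square_less_1[of "x / 2"] that by (auto simp: power_divide)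
  have rad: "1 \<le> fps_conv_radius A"
    unfolding A_def using fps_conv_radius_hypergeo[of "1/2" "- s / 2" "- s / 2"] by simp
  have rad': "1 \<le> fps_conv_radius (fps_deriv A)"
    using rad fps_conv_radius_deriv order_trans by blast
  have lt: "ereal (norm (x\<^sup>2 / 4)) < 1" if "x \<in> {-2<..<2}" for x :: real
    using in_range[OF that] by simp
  have De0: "(e0 has_real_derivative g1 x) (at x)" if "x \<in> {-2<..<2}" for x
  proof -
    have "((\<lambda>x. x\<^sup>2 / 4) has_real_derivative x / 2) (at x)"
      by (auto intro!: derivative_eq_intros)
    from DERIV_chain2[OF has_field_derivative_eval_fps[OF less_le_trans[OF lt[OF that] rad]] this]
    show ?thesis unfolding e0_def[abs_def] g1_def e1_def .
  qed
  have De1: "(e1 has_real_derivative e2 x * (x / 2)) (at x)" if "x \<in> {-2<..<2}" for x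
  proof -
    have "((\<lambda>x. x\<^sup>2 / 4) has_real_derivative x / 2) (at x)"
      by (auto intro!: derivative_eq_intros)
    from DERIV_chain2[OF has_field_derivative_eval_fps[OF less_le_trans[OF lt[OF that] rad']] this]
    show ?thesis unfolding e1_def[abs_def] e2_def .
  qed
  have Dg1: "(g1 has_real_derivative (e2 x * (x\<^sup>2 / 4) + e1 x / 2)) (at x)" if "x \<in> {-2<..<2}" for x
  proof -
    have "(g1 has_real_derivative e2 x * (x / 2) * (x / 2) + 1 / 2 * e1 x) (at x)"
      unfolding g1_def[abs_def]
      by (rule DERIV_mult[OF De1[OF that]]) (auto intro!: derivative_eq_intros)
    then show ?thesis
      by (rule DERIV_cong) (simp add: power2_eq_square)
  qed
  have Df: "(cos_moment s has_real_derivative f1 x) (at x)" for x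
    unfolding f1_def by (rule DERIV_cos_moment[OF s])
  have Df1: "(f1 has_real_derivative f2 x) (at x)" for x
    using DERIV_cmult[OF DERIV_cos_sgn_moment[of "s - 1" x], of s] s
    unfolding f1_def[abs_def] f2_def by simp
  \<comment> \<open>The moment identity times \<open>s\<close>, since \<open>f1\<close> and
    \<open>f2\<close> carry the factors \<open>s\<close> and \<open>s (s - 1)\<close> from
    differentiation.\<close>
  have ode_f: "(4 - x\<^sup>2) * f2 x = s\<^sup>2 * cos_moment s x - (2 * s - 1) * x * f1 x" for x
    using arg_cong[OF cos_moment_ode[OF s, of x], of "\<lambda>y. s * y"]
    by (simp add: f1_def f2_def algebra_simps power2_eq_square)
  \<comment> \<open>The hypergeometric equation at \<open>z = x ^ 2 / 4\<close>, times 4, rewritten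
    with the chain rule.\<close>
  have ode_g: "(4 - x\<^sup>2) * (e2 x * (x\<^sup>2 / 4) + e1 x / 2) = s\<^sup>2 * e0 x - (2 * s - 1) * x * g1 x"
    if "x \<in> {-2<..<2}" for x
  proof -
    have "x\<^sup>2 / 4 * (1 - x\<^sup>2 / 4) * e2 x + (1 / 2 - (- s / 2 + - s / 2 + 1) * (x\<^sup>2 / 4)) * e1 x
        - (- s / 2) * (- s / 2) * e0 x = 0"
      unfolding e0_def e1_def e2_def A_def
      by (rule eval_fps_hypergeo_ode) (use in_range[OF that] in auto)
    then show ?thesis
      unfolding g1_def by (simp add: field_simps power2_eq_square)
  qed
  define W where "W x = cos_moment s x * g1 x - f1 x * e0 x" for x
  define W' where "W' x = cos_moment s x * (e2 x * (x\<^sup>2 / 4) + e1 x / 2) - f2 x * e0 x" for x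
  have DW: "(W has_real_derivative W' x) (at x)" if "x \<in> {-2<..<2}" for x
    unfolding W_def[abs_def]
    by (rule DERIV_cong[OF DERIV_diff[OF DERIV_mult[OF Df Dg1[OF that]] DERIV_mult[OF Df1 De0[OF that]]]])
      (simp add: W'_def)
  have W': "(4 - x\<^sup>2) * W' x = - (2 * s - 1) * x * W x" if "x \<in> {-2<..<2}" for x
  proof -
    have "(4 - x\<^sup>2) * W' x = cos_moment s x * ((4 - x\<^sup>2) * (e2 x * (x\<^sup>2 / 4) + e1 x / 2))
        - ((4 - x\<^sup>2) * f2 x) * e0 x"
      by (simp only: W'_def algebra_simps)
    also have "\<dots> = - (2 * s - 1) * x * W x"
      unfolding ode_f ode_g[OF that] W_def by (simp add: algebra_simps)
    finally show ?thesis .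
  qed
  \<comment> \<open>Integrating factor: \<open>(4 - x ^ 2) W' = - (2 s - 1) x W\<close> is solved by
    multiples of \<open>(4 - x ^ 2) powr (s - 1/2)\<close>, so \<open>M\<close> divides by that
    power and is constant.\<close>
  define p where "p = - (s - 1/2)"
  define M where "M x = W x * (4 - x\<^sup>2) powr p" for x
  have DM: "(M has_real_derivative 0) (at x)" if "x \<in> {-2<..<2}" for x
  proof -
    have pos: "4 - x\<^sup>2 > 0" using in_range[OF that] by simp
    have "((\<lambda>x. (4 - x\<^sup>2) powr p) has_real_derivative p * (4 - x\<^sup>2) powr (p - of_nat 1) * (- 2 * x)) (at x)"
      by (rule DERIV_fun_powr) (use pos in \<open>auto intro!: derivative_eq_intros\<close>)
    from DERIV_mult[OF DW[OF that] this]
    have "(M has_real_derivative W' x * (4 - x\<^sup>2) powr p + p * (4 - x\<^sup>2) powr (p - of_nat 1) * (- 2 * x) * W x) (at x)"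
      unfolding M_def[abs_def] .
    also have "W' x * (4 - x\<^sup>2) powr p + p * (4 - x\<^sup>2) powr (p - of_nat 1) * (- 2 * x) * W x =
        (4 - x\<^sup>2) powr (p - 1) * ((4 - x\<^sup>2) * W' x + (2 * s - 1) * x * W x)"
    proof -
      define Q where "Q = (4 - x\<^sup>2) powr (p - 1)"
      have Q: "(4 - x\<^sup>2) powr p = Q * (4 - x\<^sup>2)"
        using pos by (simp add: Q_def powr_diff)
      show ?thesis
        unfolding of_nat_1 Q Q_def[symmetric] by (simp add: p_def algebra_simps)
    qed
    also have "\<dots> = 0" using W'[OF that] by (simp add: algebra_simps)
    finally show ?thesis .
  qed
  have W0: "W 0 = 0"
    using cos_sgn_moment_0[of "s - 1"] s by (simp add: W_def g1_def f1_def)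
  have W: "W x = 0" if "x \<in> {-2<..<2}" for x
  proof -
    have "M x = M 0"
      by (rule DERIV_isconst3[of "-2" 2]) (use that DM in auto)
    then have "M x = 0" by (simp add: M_def W0)
    then show ?thesis using in_range[OF that] by (simp add: M_def)
  qed
  have pos: "e0 x > 0" if "x \<in> {-2<..<2}" for x
    unfolding e0_def A_def by (rule eval_fps_hypergeo_square_pos) (use in_range[OF that] in auto)
  \<comment> \<open>The numerator of the quotient rule is \<open>- W x\<close>.\<close>
  have "((\<lambda>x. cos_moment s x / e0 x) has_real_derivative 0) (at x)" if "x \<in> {-2<..<2}" for x
    by (rule DERIV_cong[OF DERIV_divide[OF Df De0[OF that]]])
      (use W[OF that] pos[OF that] in \<open>auto simp: W_def\<close>)
  then have "cos_moment s k / e0 k = cos_moment s 0 / e0 0"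
    by (intro DERIV_isconst3[of "-2" 2]) (use k in auto)
  moreover have "e0 0 = 1"
    by (simp add: e0_def A_def eval_fps_at_0)
  moreover have "e0 k > 0"
    by (rule pos) (use k in auto)
  ultimately have "cos_moment s k = cos_moment s 0 * e0 k"
    by (simp add: field_simps)
  then show ?thesis
    by (simp only: e0_def A_def)
qed

section \<open>Reduction of the torus integral and uniqueness of the continuation\<close>

definition complex_cos_moment :: "complex \<Rightarrow> real \<Rightarrow> complex" where
  "complex_cos_moment s k = integral {0..1} (\<lambda>t. of_real \<bar>k + 2 * cos (pi * t)\<bar> powr s)"

lemma continuous_on_of_real_abs_powr:
  fixes g :: "'a::topological_space \<Rightarrow> real"
  assumes "Re s > 0" "continuous_on A g"
  shows "continuous_on A (\<lambda>x. complex_of_real \<bar>g x\<bar> powr s)"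
  using assms by (intro continuous_on_powr_complex) (auto intro!: continuous_intros)

lemma complex_cos_moment_of_real:
  assumes "s > 0"
  shows "complex_cos_moment (of_real s) k = of_real (cos_moment s k)"
proof -
  have "((\<lambda>t. \<bar>k + 2 * cos (pi * t)\<bar> powr s) has_integral cos_moment s k) {0..1}"
    unfolding cos_moment_def
    by (intro integrable_integral integrable_continuous_real continuous_on_abs_powr assms continuous_intros)
  then have "((\<lambda>t. complex_of_real (\<bar>k + 2 * cos (pi * t)\<bar> powr s)) has_integral of_real (cos_moment s k)) {0..1}"
    by (rule has_integral_of_real)
  then show ?thesis
    unfolding complex_cos_moment_def by (simp add: integral_unique powr_of_real)
qed

lemma complex_cos_moment_uminus:
  assumes "Re s > 0"
  shows "complex_cos_moment s (- k) = complex_cos_moment s k"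
proof -
  define f where "f c = complex_of_real \<bar>k + 2 * c\<bar> powr s" for c
  have f: "continuous_on {-1..1} f"
    unfolding f_def by (intro continuous_on_of_real_abs_powr assms continuous_intros)
  have "complex_of_real \<bar>- k + 2 * c\<bar> powr s = f (- c)" for c
    unfolding f_def by (simp add: abs_minus_commute)
  with integral_cos_uminus[OF f] show ?thesis
    unfolding complex_cos_moment_def by (simp add: f_def)
qed

section \<open>Holomorphy of the moment in the exponent\<close>

lemma isCont_mult_ln_0: "isCont (\<lambda>x::real. \<bar>x\<bar> * ln \<bar>x\<bar>) 0"
proof -
  have bound: "norm (\<bar>x\<bar> * ln \<bar>x\<bar>) \<le> 2 * sqrt \<bar>x\<bar>" if "x \<noteq> 0" "\<bar>x\<bar> < 1" for x :: real
  proof -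
    \<comment> \<open>The bound \<open>ln y <= y\<close> is taken at \<open>y = 1 / sqrt |x|\<close>
      rather than \<open>1 / |x|\<close>: the square root leaves a factor that tends to 0.\<close>
    have "ln (1 / sqrt \<bar>x\<bar>) \<le> 1 / sqrt \<bar>x\<bar>"
      by (rule ln_bound) (use that in simp)
    moreover have "ln (1 / sqrt \<bar>x\<bar>) = - ln \<bar>x\<bar> / 2"
      using that by (simp add: ln_div ln_sqrt)
    ultimately have "- ln \<bar>x\<bar> \<le> 2 / sqrt \<bar>x\<bar>"
      by linarith
    then have "\<bar>x\<bar> * - ln \<bar>x\<bar> \<le> \<bar>x\<bar> * (2 / sqrt \<bar>x\<bar>)"
      by (rule mult_left_mono) simp
    also have "\<dots> = 2 * sqrt \<bar>x\<bar>"
      using real_div_sqrt[of "\<bar>x\<bar>"] by (metis abs_ge_zero mult.commute times_divide_eq_left times_divide_eq_right)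
    finally show ?thesis
      using that by (simp add: abs_mult abs_of_neg)
  qed
  have "eventually (\<lambda>x. x \<in> ball (0::real) 1 - {0}) (at 0)"
    by (rule eventually_at_in_open) auto
  then have "eventually (\<lambda>x::real. norm (\<bar>x\<bar> * ln \<bar>x\<bar>) \<le> 2 * sqrt \<bar>x\<bar>) (at 0)"
    by (rule eventually_mono) (use bound in simp)
  moreover have "((\<lambda>x::real. 2 * sqrt \<bar>x\<bar>) \<longlongrightarrow> 2 * sqrt \<bar>0\<bar>) (at 0)"
    by (intro tendsto_intros)
  then have "((\<lambda>x::real. 2 * sqrt \<bar>x\<bar>) \<longlongrightarrow> 0) (at 0)"
    by simp
  ultimately have "((\<lambda>x::real. \<bar>x\<bar> * ln \<bar>x\<bar>) \<longlongrightarrow> 0) (at 0)"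
    by (rule Lim_null_comparison)
  then show ?thesis
    by (simp add: isCont_def)
qed

lemma continuous_on_abs_mult_ln: "continuous_on UNIV (\<lambda>x::real. \<bar>x\<bar> * ln \<bar>x\<bar>)"
proof (rule continuous_at_imp_continuous_on, intro ballI)
  fix x :: real
  show "isCont (\<lambda>x. \<bar>x\<bar> * ln \<bar>x\<bar>) x"
    by (cases "x = 0") (use isCont_mult_ln_0 in \<open>auto intro!: continuous_intros\<close>)
qed

lemma holomorphic_complex_cos_moment:
  "(\<lambda>s. complex_cos_moment s k) holomorphic_on {s. Re s > 1}"
proof -
  define w where "w t = k + 2 * cos (pi * t)" for t :: real
  have w: "continuous_on A w" for A
    unfolding w_def by (intro continuous_intros)
  have "(\<lambda>s. integral (cbox 0 1) (\<lambda>t. complex_of_real \<bar>w t\<bar> powr s)) holomorphic_on {s. Re s > 1}"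
  proof (rule leibniz_rule_holomorphic)
    fix s t assume s: "s \<in> {s. Re s > 1}"
    \<comment> \<open>The derivative \<open>ln |w| * |w| powr s\<close> is unmanageable at zeros of
      \<open>w\<close>, so one factor \<open>|w|\<close> is moved to the logarithm. The remaining
      exponent \<open>s - 1\<close> must have positive real part, whence the half-plane
      \<open>Re s > 1\<close>.\<close>
    show "((\<lambda>s. complex_of_real \<bar>w t\<bar> powr s) has_field_derivative
        of_real (\<bar>w t\<bar> * ln \<bar>w t\<bar>) * complex_of_real \<bar>w t\<bar> powr (s - 1)) (at s within {s. Re s > 1})"
    proof (cases "w t = 0")
      case False
      have "((\<lambda>s. complex_of_real \<bar>w t\<bar> powr s) has_field_derivative
          Ln (of_real \<bar>w t\<bar>) * complex_of_real \<bar>w t\<bar> powr s) (at s within {s. Re s > 1})"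
        using has_field_derivative_powr_right[of "of_real \<bar>w t\<bar>" s] False
        by (auto intro: has_field_derivative_at_within)
      then show ?thesis
        by (rule DERIV_cong) (use False in \<open>simp add: Ln_of_real powr_diff\<close>)
    qed auto
  next
    fix s assume "s \<in> {s. Re s > 1}"
    then show "(\<lambda>t. complex_of_real \<bar>w t\<bar> powr s) integrable_on cbox 0 1"
      by (intro integrable_continuous continuous_on_of_real_abs_powr w) auto
  next
    have ws: "continuous_on ({s::complex. Re s > 1} \<times> cbox 0 1) (\<lambda>x. w (snd x))"
      by (rule continuous_on_compose2[OF w[of UNIV]]) (auto intro!: continuous_intros)
    then have "continuous_on ({s::complex. Re s > 1} \<times> cbox 0 1) (\<lambda>x. \<bar>w (snd x)\<bar> * ln \<bar>w (snd x)\<bar>)"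
      by (rule continuous_on_compose2[OF continuous_on_abs_mult_ln]) auto
    then have "continuous_on ({s::complex. Re s > 1} \<times> cbox 0 1)
        (\<lambda>x. complex_of_real (\<bar>w (snd x)\<bar> * ln \<bar>w (snd x)\<bar>))"
      by (rule continuous_on_of_real)
    moreover have "continuous_on ({s. Re s > 1} \<times> cbox 0 1)
        (\<lambda>x. complex_of_real \<bar>w (snd x)\<bar> powr (fst x - 1))"
    proof (rule continuous_on_powr_complex)
      show "continuous_on ({s::complex. Re s > 1} \<times> cbox 0 1) (\<lambda>x. complex_of_real \<bar>w (snd x)\<bar>)"
        using ws by (intro continuous_on_of_real continuous_on_rabs)
      show "continuous_on ({s. Re s > 1} \<times> cbox 0 1) (\<lambda>x::complex \<times> real. fst x - 1)"
        by (intro continuous_intros)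
    qed auto
    ultimately show "continuous_on ({s. Re s > 1} \<times> cbox 0 1)
        (\<lambda>(s, t). of_real (\<bar>w t\<bar> * ln \<bar>w t\<bar>) * complex_of_real \<bar>w t\<bar> powr (s - 1))"
      unfolding case_prod_unfold
      by (rule continuous_on_mult)
  qed (rule convex_halfspace_Re_gt)
  then show ?thesis
    unfolding complex_cos_moment_def w_def cbox_interval .
qed

section \<open>From the torus to the interval\<close>

lemma circlepath_add_inverse:
  "circlepath 0 1 x + inverse (circlepath 0 1 x) = of_real (2 * cos (2 * pi * x))"
proof -
  define y where "y = complex_of_real (2 * pi * x)"
  have y: "2 * of_real pi * \<i> * of_real x = \<i> * y"
    unfolding y_def of_real_mult of_real_numeral by (simp only: mult_ac)
  have "circlepath 0 1 x + inverse (circlepath 0 1 x) = exp (\<i> * y) + exp (- (\<i> * y))"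
    unfolding circlepath y exp_minus by simp
  also have "\<dots> = 2 * cos y"
    unfolding cos_exp_eq by simp
  also have "\<dots> = of_real (2 * cos (2 * pi * x))"
    unfolding y_def cos_of_real by simp
  finally show ?thesis .
qed

text \<open>The factor \<open>1 / x\<close> of the integrand cancels against the derivative
  \<open>2 pi i x\<close> of the circle path.\<close>

lemma torus_pullback_zeta_mahler:
  "torus_pullback 1 (zeta_mahler_integrand 1 k s) t =
     of_real \<bar>k + 2 * cos (2 * pi * t 1)\<bar> powr s * (2 * of_real pi * \<i>)"
proof -
  define x where "x = t 1"
  have "torus_pullback 1 (zeta_mahler_integrand 1 k s) t =
      of_real (cmod (of_real k + (circlepath 0 1 x + inverse (circlepath 0 1 x)))) powr s
        / circlepath 0 1 x * vector_derivative (circlepath 0 1) (at x)"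
    by (simp add: torus_pullback_def zeta_mahler_integrand_def x_def)
  also have "vector_derivative (circlepath 0 1) (at x) = 2 * of_real pi * \<i> * circlepath 0 1 x"
    unfolding vector_derivative_circlepath by (simp add: circlepath)
  also have "of_real k + (circlepath 0 1 x + inverse (circlepath 0 1 x)) =
      complex_of_real (k + 2 * cos (2 * pi * x))"
    unfolding circlepath_add_inverse by simp
  also have "circlepath 0 1 x \<noteq> 0"
    by (simp add: circlepath)
  then have "of_real (cmod (of_real (k + 2 * cos (2 * pi * x)))) powr s / circlepath 0 1 x *
        (2 * of_real pi * \<i> * circlepath 0 1 x) =
      of_real \<bar>k + 2 * cos (2 * pi * x)\<bar> powr s * (2 * of_real pi * \<i>)"
    unfolding norm_of_real by simp
  finally show ?thesis
    by (simp add: x_def)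
qed

text \<open>The coordinate map carries the product measure over a one-element index set to
  \<open>lborel\<close>, so both integrability and the integral are those of a function of one real
  variable.\<close>

lemma zeta_mahler_torus_integral:
  assumes s: "Re s > 0"
  shows "torus_integrable 1 (zeta_mahler_integrand 1 k s)"
    and "1 / (2 * of_real pi * \<i>) ^ 1 * torus_integral 1 (zeta_mahler_integrand 1 k s) =
           complex_cos_moment s k"
proof -
  interpret product_sigma_finite "\<lambda>_::nat. lborel :: real measure"
    by standard
  define h where "h x = of_real \<bar>k + 2 * cos (2 * pi * x)\<bar> powr s * (2 * of_real pi * \<i>)" for x :: real
  define P where "P = PiM {1..1::nat} (\<lambda>_. lborel :: real measure)"
  define g where "g x = indicator {0..1} x *\<^sub>R h x" for x
  have "continuous_on {0..1} h"
    unfolding h_def by (intro continuous_intros continuous_on_of_real_abs_powr s)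
  then have h: "set_integrable lborel {0..1} h"
    by (rule borel_integrable_atLeastAtMost')
  then have g: "integrable lborel g"
    by (simp add: set_integrable_def g_def[abs_def])
  have distr: "distr P lborel (\<lambda>x. x 1) = lborel"
    using distr_singleton[of 1] by (simp add: P_def)
  have meas: "(\<lambda>x. x 1) \<in> measurable P lborel"
    unfolding P_def by measurable
  have eq: "indicator (PiE {1..1} (\<lambda>_. {0..1})) t *\<^sub>R torus_pullback 1 (zeta_mahler_integrand 1 k s) t = g (t 1)"
    if "t \<in> space P" for t
    using that unfolding torus_pullback_zeta_mahler g_def h_def P_def
    by (auto simp: space_PiM PiE_iff indicator_def)
  have "integrable P (\<lambda>t. g (t 1))"
    using g meas distr by (subst integrable_distr_eq[symmetric, where N = lborel]) auto
  then show "torus_integrable 1 (zeta_mahler_integrand 1 k s)"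
    unfolding torus_integrable_def set_integrable_def P_def[symmetric]
    by (subst Bochner_Integration.integrable_cong[OF refl eq])
  have "torus_integral 1 (zeta_mahler_integrand 1 k s) = integral\<^sup>L P (\<lambda>t. g (t 1))"
    unfolding torus_integral_def set_lebesgue_integral_def P_def[symmetric]
    by (rule Bochner_Integration.integral_cong[OF refl eq])
  also have "\<dots> = integral\<^sup>L lborel g"
    using integral_distr[OF meas, of g] g unfolding distr by simp
  also have "\<dots> = integral {0..1} h"
    using set_borel_integral_eq_integral(2)[OF h] by (simp add: set_lebesgue_integral_def g_def[abs_def])
  also have "\<dots> = integral {0..1} (\<lambda>t. of_real \<bar>k + 2 * cos (2 * pi * t)\<bar> powr s) * (2 * of_real pi * \<i>)"
    unfolding h_def by (rule integral_mult_left)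
  also have "integral {0..1} (\<lambda>t. of_real \<bar>k + 2 * cos (2 * pi * t)\<bar> powr s) = complex_cos_moment s k"
    unfolding complex_cos_moment_def
    by (rule integral_cos_full_period[of "\<lambda>c. complex_of_real \<bar>k + 2 * c\<bar> powr s"])
      (intro continuous_on_of_real_abs_powr s continuous_intros)
  finally show "1 / (2 * of_real pi * \<i>) ^ 1 * torus_integral 1 (zeta_mahler_integrand 1 k s) =
           complex_cos_moment s k"
    by simp
qed

text \<open>By the identity theorem the difference vanishes near every point, the point itself
  perhaps excepted. There the value is forced as well: 0 at a common pole, the common limit
  elsewhere.\<close>

lemma nicely_meromorphic_eqI:
  assumes f: "f nicely_meromorphic_on UNIV" and g: "g nicely_meromorphic_on UNIV"
    and eq: "\<And>s. Re s > c \<Longrightarrow> f s = g s"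
  shows "f = g"
proof
  fix z
  have "(\<lambda>s. f s - g s) meromorphic_on UNIV"
    using f g by (auto simp: nicely_meromorphic_on_def intro!: meromorphic_intros)
  then have "eventually (\<lambda>s. f s - g s = 0) (cosparse UNIV) \<or> eventually (\<lambda>s. f s - g s \<noteq> 0) (cosparse UNIV)"
    by (rule meromorphic_imp_constant_or_avoid) auto
  moreover have "\<not> eventually (\<lambda>s. f s - g s \<noteq> 0) (cosparse UNIV)"
  proof
    assume "eventually (\<lambda>s. f s - g s \<noteq> 0) (cosparse UNIV)"
    then have "eventually (\<lambda>s. f s - g s \<noteq> 0) (at (of_real (c + 1)))"
      by (simp add: eventually_cosparse_open_eq)
    moreover have "eventually (\<lambda>s. s \<in> {s. Re s > c}) (at (complex_of_real (c + 1)))"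
      by (rule eventually_at_in_open') (auto intro: open_halfspace_Re_gt)
    ultimately have "eventually (\<lambda>_. False) (at (complex_of_real (c + 1)))"
      by eventually_elim (use eq in auto)
    then show False by simp
  qed
  ultimately have "eventually (\<lambda>s. f s - g s = 0) (at z)"
    by (auto simp: eventually_cosparse_open_eq)
  then have ev: "eventually (\<lambda>s. f s = g s) (at z)"
    by eventually_elim simp
  then have pole: "is_pole f z \<longleftrightarrow> is_pole g z"
    by (rule is_pole_cong) simp
  show "f z = g z"
  proof (cases "is_pole f z")
    case True
    then show ?thesis
      using is_pole_zero_at_nicely_mero[OF f] is_pole_zero_at_nicely_mero[OF g] pole by simp
  next
    case False
    then have "f \<midarrow>z\<rightarrow> f z" "g \<midarrow>z\<rightarrow> g z"
      using f g pole by (auto simp: nicely_meromorphic_on_def)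
    then have "g \<midarrow>z\<rightarrow> f z"
      using tendsto_cong[OF ev] by blast
    with \<open>g \<midarrow>z\<rightarrow> g z\<close> show ?thesis
      using LIM_unique by blast
  qed
qed

lemma zeta_mahler_eqI:
  assumes f: "f nicely_meromorphic_on UNIV"
    and eq: "\<And>s. Re s > 1 \<Longrightarrow> f s = complex_cos_moment s k"
  shows "zeta_mahler 1 k = f"
  unfolding zeta_mahler_def
proof (rule the_equality)
  show "is_zeta_mahler 1 k f"
    unfolding is_zeta_mahler_def
    using f eq zeta_mahler_torus_integral[of _ k] by (intro conjI exI[of _ 1]) auto
next
  fix g assume "is_zeta_mahler 1 k g"
  then obtain c where g: "g nicely_meromorphic_on UNIV" "\<And>s. Re s > c \<Longrightarrow>
      g s = 1 / (2 * of_real pi * \<i>) ^ 1 * torus_integral 1 (zeta_mahler_integrand 1 k s)"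
    unfolding is_zeta_mahler_def by auto
  show "g = f"
  proof (rule nicely_meromorphic_eqI[OF g(1) f])
    \<comment> \<open>A rival continuation may come with another half-plane; the comparison takes
      place where both are known to equal the integral.\<close>
    fix s assume "Re s > max c 1"
    then show "g s = f s"
      using g(2)[of s] eq[of s] zeta_mahler_torus_integral(2)[of s k] by simp
  qed
qed

text \<open>The real numbers above 2 accumulate at 3, inside the connected half-plane where both
  sides are holomorphic. So the moment has to be computed only for real exponents, where the
  differential equation and positivity are available.\<close>

lemma zeta_mahler_eqI_real:
  assumes f: "f nicely_meromorphic_on UNIV" "f holomorphic_on {s. Re s > 1}"
    and eq: "\<And>s. s > 2 \<Longrightarrow> f (of_real s) = of_real (cos_moment s k)"
  shows "zeta_mahler 1 k = f"
proof (rule zeta_mahler_eqI[OF f(1)])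
  fix s :: complex assume s: "Re s > 1"
  have "f s - complex_cos_moment s k = 0"
  proof (rule analytic_continuation[of "\<lambda>s. f s - complex_cos_moment s k" "{s. Re s > 1}" "of_real ` {2<..}" 3])
    show "(\<lambda>s. f s - complex_cos_moment s k) holomorphic_on {s. Re s > 1}"
      by (intro holomorphic_intros f holomorphic_complex_cos_moment)
    show "open {s. Re s > 1}" "connected {s. Re s > 1}"
      by (auto intro: open_halfspace_Re_gt convex_connected convex_halfspace_Re_gt)
    have "(3::real) islimpt {2<..}"
      by (intro interior_limit_point) (auto simp: interior_open)
    moreover have "eventually (\<lambda>x. complex_of_real x \<noteq> of_real 3) (at 3)"
      unfolding eventually_at_filter of_real_eq_iff by simp
    ultimately have "complex_of_real 3 islimpt of_real ` {2<..}"
      by (intro islimpt_isCont_image) auto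
    then show "3 islimpt complex_of_real ` {2<..}" by simp
    show "f z - complex_cos_moment z k = 0" if "z \<in> of_real ` {2<..}" for z
      using that eq complex_cos_moment_of_real by auto
  qed (use s in auto)
  then show "f s = complex_cos_moment s k" by simp
qed

section \<open>Special values\<close>

text \<open>Where the Gamma factor has a pole, \<open>h z \<noteq> 0\<close> keeps it a pole of the
  product, and the value 0 of \<open>Gamma\<close> there is the one that the convention demands. A
  zero of \<open>h\<close> could cancel the pole and leave a nonzero limit.\<close>

lemma nicely_meromorphic_Gamma_mult:
  assumes a: "a \<noteq> 0" and h: "h holomorphic_on UNIV"
    and nz: "\<And>z. a * z + c \<in> \<int>\<^sub>\<le>\<^sub>0 \<Longrightarrow> h z \<noteq> 0"
  shows "(\<lambda>z. Gamma (a * z + c) * h z) nicely_meromorphic_on UNIV"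
  unfolding nicely_meromorphic_on_def
proof (intro conjI ballI)
  have "(\<lambda>z. inverse (rGamma (a * z + c)) * h z) meromorphic_on UNIV"
    using h by (intro meromorphic_intros analytic_on_imp_meromorphic_on analytic_intros)
      (simp add: analytic_on_open)
  then show "(\<lambda>z. Gamma (a * z + c) * h z) meromorphic_on UNIV"
    by (simp only: Gamma_def)
next
  fix z
  have hz: "isCont h z"
    using h holomorphic_on_imp_continuous_on continuous_on_eq_continuous_at by blast
  show "is_pole (\<lambda>z. Gamma (a * z + c) * h z) z \<and> Gamma (a * z + c) * h z = 0 \<or>
      (\<lambda>z. Gamma (a * z + c) * h z) \<midarrow>z\<rightarrow> Gamma (a * z + c) * h z"
  proof (cases "a * z + c \<in> \<int>\<^sub>\<le>\<^sub>0")
    case True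
    then obtain n where n: "a * z + c = - of_nat n"
      by (elim nonpos_Ints_cases')
    have "is_pole Gamma (a * z + c)"
      unfolding n by (rule is_pole_Gamma)
    then have "is_pole (\<lambda>z. Gamma (a * z + c)) z"
    proof (rule is_pole_compose)
      show "(\<lambda>z. a * z + c) \<midarrow>z\<rightarrow> a * z + c"
        by (intro tendsto_intros)
      show "eventually (\<lambda>w. a * w + c \<noteq> a * z + c) (at z)"
        using a by (simp add: eventually_at_filter)
    qed
    then have "is_pole (\<lambda>z. h z * Gamma (a * z + c)) z"
      unfolding is_pole_def using hz nz[OF True]
      by (intro tendsto_mult_filterlim_at_infinity) (auto simp: isCont_def)
    moreover have "Gamma (a * z + c) = 0"
      using True by (simp add: Gamma_eq_zero_iff)
    ultimately show ?thesis
      by (simp add: mult.commute)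
  next
    case False
    then have "isCont (\<lambda>z. Gamma (a * z + c) * h z) z"
      by (intro continuous_intros hz) auto
    then show ?thesis
      by (simp add: isCont_def)
  qed
qed

section \<open>Closed forms of particular moments\<close>

lemma Gamma_half_duplication:
  fixes s :: complex
  assumes "(1 + s) / 2 \<notin> \<int>\<^sub>\<le>\<^sub>0" "1 + s / 2 \<notin> \<int>\<^sub>\<le>\<^sub>0"
  shows "Gamma ((1 + s) / 2) * Gamma (1 + s / 2) = 2 powr (- s) * of_real (sqrt pi) * Gamma (1 + s)"
proof -
  have eq: "(1 + s) / 2 + 1 / 2 = 1 + s / 2" "2 * ((1 + s) / 2) = 1 + s"
    by (simp_all add: field_simps)
  show ?thesis
    using Gamma_legendre_duplication[of "(1 + s) / 2"] assms unfolding eq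
    by (simp add: powr_def Ln_of_real[of 2, simplified])
qed

lemma pos_notin_nonpos_Ints: "x > 0 \<Longrightarrow> complex_of_real x \<notin> \<int>\<^sub>\<le>\<^sub>0"
  by (auto elim!: nonpos_Ints_cases' simp: complex_eq_iff)

lemma cos_pi_nonneg:
  assumes "0 \<le> t" "t \<le> 1/2"
  shows "cos (pi * t) \<ge> 0"
proof -
  have "0 \<le> pi * t" "pi * t \<le> pi / 2"
    using assms by auto
  then show ?thesis
    using pi_gt_zero by (intro cos_ge_zero) linarith+
qed

lemma cos_moment_0:
  assumes s: "s > 0"
  shows "cos_moment s 0 = 2 powr s * Beta ((s + 1) / 2) (1/2) / pi"
proof -
  have "cos_moment s 0 = 2 *\<^sub>R integral {0..1/2} (\<lambda>t. \<bar>2 * cos (pi * t)\<bar> powr s)"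
    unfolding cos_moment_def add_0
    by (rule integral_symmetric_double)
      (auto intro!: continuous_on_abs_powr s continuous_intros simp: right_diff_distrib cos_diff)
  also have "integral {0..1/2} (\<lambda>t. \<bar>2 * cos (pi * t)\<bar> powr s) =
      integral {0..1/2} (\<lambda>t. 2 powr s * cos (pi * t) powr s)"
  proof (rule integral_cong)
    fix t :: real assume "t \<in> {0..1/2}"
    then have "cos (pi * t) \<ge> 0"
      by (intro cos_pi_nonneg) auto
    then show "\<bar>2 * cos (pi * t)\<bar> powr s = 2 powr s * cos (pi * t) powr s"
      by (simp add: powr_mult)
  qed
  also have "\<dots> = 2 powr s * (Beta ((s + 1) / 2) (1/2) / (2 * pi))"
    using has_integral_mult_right[OF has_integral_cos_powr[of s]] s by (intro integral_unique) auto
  finally show ?thesis by simp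
qed

lemma cos_moment_2:
  assumes s: "s > 0"
  shows "cos_moment s 2 = 4 powr s * Beta (s + 1/2) (1/2) / pi"
proof -
  \<comment> \<open>The exponent is doubled because
    \<open>2 + 2 cos (pi t) = 4 cos (pi t / 2) ^ 2\<close>.\<close>
  have "((\<lambda>t. cos (pi * t) powr (2 * s)) has_integral Beta ((2 * s + 1) / 2) (1/2) / (2 * pi)) (cbox 0 (1/2))"
    using has_integral_cos_powr[of "2 * s"] s by simp
  from has_integral_affinity'[OF this, of "1/2" 0]
  have "((\<lambda>t. cos (pi * (t / 2)) powr (2 * s)) has_integral Beta ((2 * s + 1) / 2) (1/2) / pi) {0..1}"
    by simp
  from has_integral_mult_right[OF this, of "4 powr s"]
  have "((\<lambda>t. 4 powr s * cos (pi * (t / 2)) powr (2 * s)) has_integral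
      4 powr s * (Beta ((2 * s + 1) / 2) (1/2) / pi)) {0..1}" .
  moreover have "4 powr s * cos (pi * (t / 2)) powr (2 * s) = \<bar>2 + 2 * cos (pi * t)\<bar> powr s"
    if "t \<in> {0..1}" for t
  proof -
    define c where "c = cos (pi * (t / 2))"
    have c: "c \<ge> 0"
      unfolding c_def by (rule cos_pi_nonneg) (use that in auto)
    have "c powr (2 * s) = c powr s * c powr s"
      by (simp flip: powr_add)
    also have "\<dots> = (c * c) powr s"
      using c by (simp only: powr_mult)
    finally have "4 powr s * c powr (2 * s) = (4 * (c * c)) powr s"
      using c by (simp only: powr_mult)
    also have "4 * (c * c) = 2 + 2 * cos (2 * (pi * (t / 2)))"
      unfolding cos_double_cos c_def by (simp only: power2_eq_square) simp
    also have "\<dots> = \<bar>2 + 2 * cos (pi * t)\<bar>"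
    proof -
      have "2 + 2 * cos (pi * t) \<ge> 0"
        using cos_ge_minus_one[of "pi * t"] by linarith
      then show ?thesis by simp
    qed
    finally have "4 powr s * c powr (2 * s) = \<bar>2 + 2 * cos (pi * t)\<bar> powr s" .
    then show ?thesis
      by (simp only: c_def)
  qed
  ultimately have "((\<lambda>t. \<bar>2 + 2 * cos (pi * t)\<bar> powr s) has_integral
      4 powr s * (Beta ((2 * s + 1) / 2) (1/2) / pi)) {0..1}"
    by (rule has_integral_eq[rotated])
  then show ?thesis
    unfolding cos_moment_def by (simp add: integral_unique add_divide_distrib)
qed

text \<open>The Wallis integral, that is \<open>(2 m choose m) / 4 ^ m\<close>, kept in Pochhammer
  form to match hypergeometric coefficients.\<close>

lemma cos_power_even:
  "integral {0..1} (\<lambda>t. cos (pi * t) ^ (2 * m)) = pochhammer (1/2) m / fact m"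
proof -
  have "integral {0..1} (\<lambda>t. cos (pi * t) ^ (2 * m)) = 2 *\<^sub>R integral {0..1/2} (\<lambda>t. cos (pi * t) ^ (2 * m))"
    by (rule integral_symmetric_double)
      (auto intro!: continuous_intros simp: right_diff_distrib cos_diff)
  also have "integral {0..1/2} (\<lambda>t. cos (pi * t) ^ (2 * m)) = Beta ((real (2 * m) + 1) / 2) (1/2) / (2 * pi)"
  proof (rule integral_unique)
    have I: "((\<lambda>t. cos (pi * t) powr real (2 * m)) has_integral Beta ((real (2 * m) + 1) / 2) (1/2) / (2 * pi)) {0..1/2}"
      by (rule has_integral_cos_powr) simp
    \<comment> \<open>The point 1/2 is excluded because the cosine is 0 there, and for
      \<open>m = 0\<close> the two powers differ: \<open>0 ^ 0 = 1\<close> but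
      \<open>0 powr 0 = 0\<close>.\<close>
    have eq: "cos (pi * t) ^ (2 * m) = cos (pi * t) powr real (2 * m)" if "t \<in> {0..1/2} - {1/2}" for t
    proof -
      have "0 \<le> pi * t" "pi * t < pi / 2"
        using that by auto
      then have "cos (pi * t) > 0"
        using pi_gt_zero by (intro cos_gt_zero_pi) linarith+
      then show ?thesis by (rule powr_realpow[symmetric])
    qed
    show "((\<lambda>t. cos (pi * t) ^ (2 * m)) has_integral Beta ((real (2 * m) + 1) / 2) (1/2) / (2 * pi)) {0..1/2}"
      by (rule has_integral_spike[OF negligible_sing[of "1/2"] eq I]) simp_all
  qed
  also have "2 *\<^sub>R (Beta ((real (2 * m) + 1) / 2) (1/2) / (2 * pi)) = Beta (1/2 + real m) (1/2) / pi"
    by (simp add: add_divide_distrib add.commute)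
  also have "\<dots> = pochhammer (1/2) m / fact m"
  proof -
    have "(1/2 :: real) \<notin> \<int>\<^sub>\<le>\<^sub>0"
      by (auto elim!: nonpos_Ints_cases')
    then have "Gamma (1/2 + real m) = pochhammer (1/2) m * sqrt pi"
      using pochhammer_Gamma[of "1/2 :: real" m] by (simp add: Gamma_one_half_real)
    moreover have "Gamma (1/2 + real m + 1/2) = fact m"
    proof -
      have "1/2 + real m + 1/2 = 1 + real m" by simp
      then show ?thesis by (simp only: Gamma_fact)
    qed
    ultimately show ?thesis
      by (simp add: Beta_def Gamma_one_half_real mult.assoc)
  qed
  finally show ?thesis .
qed

lemma cos_power_odd:
  assumes "odd n"
  shows "integral {0..1} (\<lambda>t. cos (pi * t) ^ n) = 0"
proof -
  have "continuous_on {-1..1} (\<lambda>c::real. c ^ n)"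
    by (intro continuous_intros)
  from integral_cos_uminus[OF this] assms show ?thesis
    by simp
qed

section \<open>The binomial expansion\<close>

lemma complex_cos_moment_abs:
  assumes "Re s > 0"
  shows "complex_cos_moment s \<bar>k\<bar> = complex_cos_moment s k"
  using complex_cos_moment_uminus[OF assms, of k] by (cases "k \<ge> 0") auto

lemma cos_moment_abs:
  assumes "s > 0"
  shows "cos_moment s \<bar>k\<bar> = cos_moment s k"
  using complex_cos_moment_abs[of "of_real s" k] assms by (simp add: complex_cos_moment_of_real)

text \<open>Duplication splits \<open>pochhammer (- s) (2 m)\<close> into the two upper parameters
  and \<open>fact (2 m)\<close> into \<open>pochhammer (1/2) m * fact m\<close>, each with a factor
  \<open>4 ^ m\<close>. The Pochhammer symbol of 1/2 then cancels against the cosine integral. The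
  remaining \<open>4 ^ m\<close> belongs to the argument \<open>4 / k ^ 2\<close>.\<close>

lemma gbinomial_even_eq_pochhammer:
  fixes s :: complex
  shows "(s gchoose (2 * m)) * (pochhammer (1/2) m / fact m) * 4 ^ m
    = pochhammer (- s / 2) m * pochhammer ((1 - s) / 2) m / (pochhammer 1 m * fact m) * 4 ^ m"
proof -
  have ne: "pochhammer (1/2 :: complex) m \<noteq> 0"
    using pochhammer_pos[of "1/2 :: real" m] pochhammer_of_real[of "1/2" m, where 'a = complex] by simp
  have "(s gchoose (2 * m)) = pochhammer (- s) (2 * m) / fact (2 * m)"
    by (simp add: gbinomial_pochhammer)
  also have "pochhammer (- s) (2 * m) = 4 ^ m * (pochhammer (- s / 2) m * pochhammer ((1 - s) / 2) m)"
    using pochhammer_double[of "- s / 2" m] by (simp add: power_mult add_divide_distrib diff_divide_distrib)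
  also have "fact (2 * m) = (4 ^ m * (pochhammer (1/2) m * fact m) :: complex)"
    using fact_double[of m, where 'a = complex] by (simp add: power_mult)
  finally show ?thesis
    using ne by (simp add: pochhammer_fact[symmetric] field_simps)
qed

text \<open>With \<open>u = 2 / k < 1\<close> the base is \<open>k (1 + u cos (pi t))\<close> and
  stays positive, so \<open>s\<close> is arbitrary. The binomial series is dominated by its values
  at \<open>u\<close>, uniformly in \<open>t\<close>, and may be integrated term by term.\<close>

lemma complex_cos_moment_eq_hypergeometric:
  assumes k: "k > 2" 
  shows "complex_cos_moment s k =
           of_real k powr s * hypergeometric [- s / 2, (1 - s) / 2] [1] (of_real (4 / k\<^sup>2))"
proof -
  define u where "u = 2 / k"
  have u: "0 < u" "u < 1" using k by (auto simp: u_def)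
  define M where "M n = norm (s gchoose n) * u ^ n" for n
  have M: "summable M"
  proof -
    have "ereal (norm (complex_of_real u)) < conv_radius (\<lambda>n. s gchoose n)"
      using u by (simp add: conv_radius_gchoose)
    then show ?thesis
      using abs_summable_in_conv_radius[of "complex_of_real u" "\<lambda>n. s gchoose n"] u
      by (simp add: M_def[abs_def] norm_mult norm_power)
  qed
  define F where "F N t = (\<Sum>n<N. (s gchoose n) * of_real (u * cos (pi * t)) ^ n)" for N t
  have lim: "uniform_limit {0..1} F (\<lambda>t. \<Sum>n. (s gchoose n) * of_real (u * cos (pi * t)) ^ n) sequentially"
    unfolding F_def
  proof (rule Weierstrass_m_test)
    fix n t
    have "\<bar>u * cos (pi * t)\<bar> ^ n \<le> u ^ n"
      using u by (intro power_mono) (auto simp: abs_mult mult_left_le)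
    then show "norm ((s gchoose n) * of_real (u * cos (pi * t)) ^ n) \<le> M n"
      unfolding M_def norm_mult norm_power norm_of_real by (intro mult_left_mono) auto
  qed (rule M)
  obtain I J where IJ: "\<And>N. (F N has_integral I N) {0..1}"
      "((\<lambda>t. \<Sum>n. (s gchoose n) * of_real (u * cos (pi * t)) ^ n) has_integral J) {0..1}" "I \<longlonglongrightarrow> J"
    by (rule uniform_limit_integral[OF lim]) (auto simp: F_def intro!: continuous_intros)
  define b where "b n = (s gchoose n) * of_real (u ^ n * integral {0..1} (\<lambda>t. cos (pi * t) ^ n))" for n
  have "(F N has_integral (\<Sum>n<N. b n)) {0..1}" for N
    unfolding F_def
  proof (rule has_integral_sum)
    fix n
    have "((\<lambda>t. cos (pi * t) ^ n) has_integral integral {0..1} (\<lambda>t. cos (pi * t) ^ n)) {0..1}"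
      by (intro integrable_integral integrable_continuous_real continuous_intros)
    from has_integral_mult_right[OF has_integral_of_real[OF has_integral_mult_right[OF this, of "u ^ n"]], of "s gchoose n"]
    show "((\<lambda>t. (s gchoose n) * of_real (u * cos (pi * t)) ^ n) has_integral b n) {0..1}"
      by (simp add: b_def power_mult_distrib)
  qed simp
  then have "I = (\<lambda>N. \<Sum>n<N. b n)"
    using has_integral_unique[OF IJ(1)] by blast
  then have "b sums J"
    using IJ(3) by (simp add: sums_def)
  \<comment> \<open>The odd powers of the cosine integrate to 0.\<close>
  then have "(\<lambda>m. b (2 * m)) sums J"
    by (subst sums_mono_reindex) (auto simp: strict_mono_def b_def intro!: cos_power_odd elim!: oddE)
  also have "(\<lambda>m. b (2 * m)) = (\<lambda>m. fps_hypergeo [- s / 2, (1 - s) / 2] [1] 1 $ m * of_real (4 / k\<^sup>2) ^ m)"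
  proof
    fix m
    have "u ^ (2 * m) = 4 ^ m * (1 / k\<^sup>2) ^ m"
      by (simp add: u_def power_mult power_divide)
    then have "b (2 * m) = (s gchoose (2 * m)) * (pochhammer (1/2) m / fact m) * 4 ^ m * of_real (1 / k\<^sup>2) ^ m"
      using pochhammer_of_real[of "1/2" m, where 'a = complex]
      by (simp add: b_def cos_power_even)
    also have "\<dots> = fps_hypergeo [- s / 2, (1 - s) / 2] [1] 1 $ m * of_real (4 / k\<^sup>2) ^ m"
      unfolding gbinomial_even_eq_pochhammer fps_hypergeo_2_1_nth by (simp add: power_divide)
    finally show "b (2 * m) = fps_hypergeo [- s / 2, (1 - s) / 2] [1] 1 $ m * of_real (4 / k\<^sup>2) ^ m" .
  qed
  finally have J: "J = hypergeometric [- s / 2, (1 - s) / 2] [1] (of_real (4 / k\<^sup>2))"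
    unfolding hypergeometric_def eval_fps_def by (simp only: sums_iff)
  have "complex_of_real \<bar>k + 2 * cos (pi * t)\<bar> powr s =
      of_real k powr s * (\<Sum>n. (s gchoose n) * of_real (u * cos (pi * t)) ^ n)" for t
  proof -
    have "\<bar>u * cos (pi * t)\<bar> \<le> u * 1"
      using u unfolding abs_mult by (intro mult_mono) auto
    with u have c: "\<bar>u * cos (pi * t)\<bar> < 1" by simp
    then have "(\<lambda>n. (s gchoose n) * of_real (u * cos (pi * t)) ^ n) sums (1 + of_real (u * cos (pi * t))) powr s"
      by (intro gen_binomial_complex) (simp only: norm_of_real)
    moreover have "\<bar>k + 2 * cos (pi * t)\<bar> = k * (1 + u * cos (pi * t))"
    proof -
      have "k + 2 * cos (pi * t) = k * (1 + u * cos (pi * t))"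
        using k by (simp add: u_def field_simps)
      moreover have "\<dots> \<ge> 0"
        using k c by (intro mult_nonneg_nonneg) auto
      ultimately show ?thesis by simp
    qed
    moreover have "complex_of_real (k * (1 + u * cos (pi * t))) powr s =
        of_real k powr s * of_real (1 + u * cos (pi * t)) powr s"
      using k c unfolding of_real_mult by (intro powr_times_real) auto
    ultimately show ?thesis
      by (simp add: sums_iff)
  qed
  then show ?thesis
    unfolding complex_cos_moment_def using IJ(2) J by (simp add: integral_unique)
qed

section \<open>The three cases\<close>

lemma Gamma_half_duplication_of_real:
  fixes s :: real
  assumes "s > 0"
  defines "S \<equiv> complex_of_real s"
  shows "Gamma ((1 + S) / 2) * Gamma (1 + S / 2) * 2 powr S = of_real (sqrt pi) * Gamma (1 + S)"
    and "Gamma ((1 + S) / 2) \<noteq> 0" "Gamma (1 + S / 2) \<noteq> 0" "Gamma (1 + S) \<noteq> 0"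
proof -
  have n: "(1 + S) / 2 \<notin> \<int>\<^sub>\<le>\<^sub>0" "1 + S / 2 \<notin> \<int>\<^sub>\<le>\<^sub>0" "1 + S \<notin> \<int>\<^sub>\<le>\<^sub>0"
    using pos_notin_nonpos_Ints[of "(1 + s) / 2"] pos_notin_nonpos_Ints[of "1 + s / 2"]
      pos_notin_nonpos_Ints[of "1 + s"] assms(1) by (simp_all add: S_def)
  then show "Gamma ((1 + S) / 2) \<noteq> 0" "Gamma (1 + S / 2) \<noteq> 0" "Gamma (1 + S) \<noteq> 0"
    by (simp_all only: Gamma_eq_zero_iff not_False_eq_True)
  show "Gamma ((1 + S) / 2) * Gamma (1 + S / 2) * 2 powr S = of_real (sqrt pi) * Gamma (1 + S)"
    unfolding Gamma_half_duplication[OF n(1,2)] by (simp add: powr_minus)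
qed

text \<open>A power of a positive base times a series holomorphic in its parameters is entire, so
  there are no poles to account for.\<close>

lemma zeta_mahler_of_abs_gt_2:
  assumes k: "\<bar>k\<bar> > 2"
  shows "zeta_mahler 1 k =
    (\<lambda>s. of_real \<bar>k\<bar> powr s * hypergeometric [- s / 2, (1 - s) / 2] [1] (of_real (4 / k\<^sup>2)))"
proof (rule zeta_mahler_eqI)
  have "4 / k\<^sup>2 < 1"
  proof -
    have "2\<^sup>2 < \<bar>k\<bar>\<^sup>2"
      using k by (intro power_strict_mono) auto
    then show ?thesis by (simp add: divide_less_eq)
  qed
  then have "norm (complex_of_real (4 / k\<^sup>2)) < 1"
    unfolding norm_of_real by simp
  then have "(\<lambda>s. hypergeometric [- s / 2, (1 - s) / 2] [of_real 1] (of_real (4 / k\<^sup>2))) holomorphic_on UNIV"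
    by (intro hypergeometric_holomorphic) (auto intro!: holomorphic_intros)
  moreover have "complex_of_real \<bar>k\<bar> \<noteq> 0"
    using k by simp
  ultimately have "(\<lambda>s. of_real \<bar>k\<bar> powr s * hypergeometric [- s / 2, (1 - s) / 2] [1] (of_real (4 / k\<^sup>2)))
      holomorphic_on UNIV"
    unfolding powr_def by (auto intro!: holomorphic_intros)
  then show "(\<lambda>s. of_real \<bar>k\<bar> powr s * hypergeometric [- s / 2, (1 - s) / 2] [1] (of_real (4 / k\<^sup>2)))
      nicely_meromorphic_on UNIV"
    by (intro analytic_on_imp_nicely_meromorphic_on) (simp add: analytic_on_open)
next
  fix s :: complex assume "Re s > 1"
  then show "of_real \<bar>k\<bar> powr s * hypergeometric [- s / 2, (1 - s) / 2] [1] (of_real (4 / k\<^sup>2)) =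
      complex_cos_moment s k"
    using complex_cos_moment_eq_hypergeometric[OF k, of s] complex_cos_moment_abs[of s k] by simp
qed

text \<open>As \<open>rGamma\<close> is entire, all poles come from one Gamma factor;
  \<open>1 * s\<close> gives it the shape \<open>a * z + c\<close> of
  \<open>nicely_meromorphic_Gamma_mult\<close>.\<close>

lemma zeta_mahler_of_abs_eq_2:
  assumes k: "\<bar>k\<bar> = 2"
  shows "zeta_mahler 1 k =
    (\<lambda>s. Gamma (1 * s + 1 / 2) * (2 powr s * rGamma (1 + s / 2) * rGamma ((1 + s) / 2)))"
proof (rule zeta_mahler_eqI_real)
  have hol: "(\<lambda>s::complex. 2 powr s * rGamma (1 + s / 2) * rGamma ((1 + s) / 2)) holomorphic_on UNIV"
    unfolding powr_def by (auto intro!: holomorphic_intros)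
  show "(\<lambda>s. Gamma (1 * s + 1 / 2) * (2 powr s * rGamma (1 + s / 2) * rGamma ((1 + s) / 2)))
      nicely_meromorphic_on UNIV"
  proof (rule nicely_meromorphic_Gamma_mult[OF _ hol])
    \<comment> \<open>At a pole \<open>z = - 1/2 - n\<close> the other two arguments are
      \<open>3/4 - n/2\<close> and \<open>1/4 - n/2\<close>, never integers. Cleared of
      denominators, this is the parity contradiction below.\<close>
    fix z :: complex assume "1 * z + 1 / 2 \<in> \<int>\<^sub>\<le>\<^sub>0"
    then obtain n :: nat where n: "1 * z + 1 / 2 = - of_nat n"
      by (elim nonpos_Ints_cases')
    then have "z = - of_nat n - 1 / 2"
      by (simp add: eq_diff_eq)
    then have z: "z = of_real (- 1/2 - real n)"
      by simp
    have "(1 + z / 2) \<notin> \<int>\<^sub>\<le>\<^sub>0"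
    proof
      assume "1 + z / 2 \<in> \<int>\<^sub>\<le>\<^sub>0"
      then obtain m :: nat where "1 + z / 2 = - of_nat m"
        by (elim nonpos_Ints_cases')
      then have "1 + (- 1/2 - real n) / 2 = - real m"
        unfolding z by (simp add: complex_eq_iff)
      then have "3 + 4 * real m = 2 * real n" by (simp add: field_simps)
      then have "real (3 + 4 * m) = real (2 * n)" by simp
      then have "3 + 4 * m = 2 * n" by (simp only: of_nat_eq_iff)
      then show False by presburger
    qed
    moreover have "(1 + z) / 2 \<notin> \<int>\<^sub>\<le>\<^sub>0"
    proof
      assume "(1 + z) / 2 \<in> \<int>\<^sub>\<le>\<^sub>0"
      then obtain m :: nat where "(1 + z) / 2 = - of_nat m"
        by (elim nonpos_Ints_cases')
      then have "(1 + (- 1/2 - real n)) / 2 = - real m"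
        unfolding z by (simp add: complex_eq_iff)
      then have "1 + 4 * real m = 2 * real n" by (simp add: field_simps)
      then have "real (1 + 4 * m) = real (2 * n)" by simp
      then have "1 + 4 * m = 2 * n" by (simp only: of_nat_eq_iff)
      then show False by presburger
    qed
    ultimately show "2 powr z * rGamma (1 + z / 2) * rGamma ((1 + z) / 2) \<noteq> 0"
      by (simp add: rGamma_eq_zero_iff)
  qed simp
  show "(\<lambda>s. Gamma (1 * s + 1 / 2) * (2 powr s * rGamma (1 + s / 2) * rGamma ((1 + s) / 2)))
      holomorphic_on {s. 1 < Re s}"
    by (rule holomorphic_on_mult[OF holomorphic_Gamma' holomorphic_on_subset[OF hol]])
      (auto elim!: nonpos_Ints_cases' simp: complex_eq_iff intro!: holomorphic_intros)
next
  fix s :: real assume s: "s > 2"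
  define S where "S = complex_of_real s"
  define P where "P = (2::complex) powr S"
  define q where "q = complex_of_real (sqrt pi)"
  have P: "P \<noteq> 0" and q: "q \<noteq> 0" by (simp_all add: P_def q_def)
  have qq: "complex_of_real pi = q * q"
    unfolding q_def of_real_mult[symmetric] by simp
  have PP: "complex_of_real (4 powr s) = P * P"
  proof -
    have "4 powr s = 2 powr s * 2 powr s"
      by (simp flip: powr_mult)
    then show ?thesis
      using powr_of_real[of 2 s] by (simp add: P_def S_def)
  qed
  note dup = Gamma_half_duplication_of_real[of s, folded S_def, folded P_def q_def]
  have B: "complex_of_real (Beta (s + 1/2) (1/2)) = Gamma (S + 1/2) * q / Gamma (1 + S)"
    unfolding Beta_def Gamma_one_half_real
    by (simp add: S_def q_def add.commute flip: Gamma_complex_of_real)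
  have "Gamma (1 * S + 1/2) * (P * rGamma (1 + S / 2) * rGamma ((1 + S) / 2)) =
      P * P * (Gamma (S + 1/2) * q / Gamma (1 + S)) / (q * q)"
  proof -
    \<comment> \<open>Duplication trades \<open>q * g\<close> for \<open>a * b * P\<close>, which
      turns the Beta value into the two reciprocal Gamma factors.\<close>
    define a b g where "a = Gamma ((1 + S) / 2)" and "b = Gamma (1 + S / 2)" and "g = Gamma (1 + S)"
    have d: "a * b * P = q * g" "a \<noteq> 0" "b \<noteq> 0" "g \<noteq> 0"
      using dup s by (simp_all add: a_def b_def g_def)
    define G where "G = Gamma (S + 1/2)"
    have "P * P * (G * q / g) / (q * q) = P * P * G / (q * g)"
      using q by (simp add: mult_ac)
    also have "\<dots> = P * P * G / (a * b * P)"
      by (simp only: d)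
    also have "\<dots> = G * (P * inverse b * inverse a)"
      using P by (simp add: divide_inverse mult_ac)
    finally show ?thesis
      unfolding rGamma_inverse_Gamma a_def[symmetric] b_def[symmetric] g_def[symmetric] G_def
      by (simp only: mult_1)
  qed
  also have "\<dots> = of_real (4 powr s * Beta (s + 1/2) (1/2) / pi)"
    unfolding of_real_mult of_real_divide B qq PP ..
  also have "4 powr s * Beta (s + 1/2) (1/2) / pi = cos_moment s k"
    using cos_moment_2[of s] cos_moment_abs[of s k] s k by simp
  finally show "Gamma (1 * of_real s + 1 / 2) *
      (2 powr complex_of_real s * rGamma (1 + of_real s / 2) * rGamma ((1 + of_real s) / 2)) = of_real (cos_moment s k)"
    by (simp only: S_def P_def)
qed

text \<open>In this form the poles can only be \<open>s = - 1 - 2 n\<close>. There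
  \<open>1 + s / 2\<close> is \<open>1/2 - n\<close>, so \<open>rGamma\<close> does not vanish and
  only the hypergeometric factor needs an argument.\<close>

lemma zeta_mahler_of_abs_lt_2:
  assumes k: "\<bar>k\<bar> < 2"
  shows "zeta_mahler 1 k =
    (\<lambda>s. Gamma (1 / 2 * s + 1 / 2) * (2 powr s / of_real (sqrt pi) * rGamma (1 + s / 2) *
      hypergeometric [- s / 2, - s / 2] [1 / 2] (of_real (k\<^sup>2 / 4))))"
proof (rule zeta_mahler_eqI_real)
  have kk: "k\<^sup>2 / 4 < 1"
    using abs_square_less_1[of "k / 2"] k by (simp add: power_divide)
  then have "norm (complex_of_real (k\<^sup>2 / 4)) < 1"
    unfolding norm_of_real by simp
  then have "(\<lambda>s. hypergeometric [- s / 2, - s / 2] [of_real (1/2)] (of_real (k\<^sup>2 / 4))) holomorphic_on UNIV"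
    by (intro hypergeometric_holomorphic) (auto intro!: holomorphic_intros)
  then have hol: "(\<lambda>s::complex. 2 powr s / of_real (sqrt pi) * rGamma (1 + s / 2) *
      hypergeometric [- s / 2, - s / 2] [1 / 2] (of_real (k\<^sup>2 / 4))) holomorphic_on UNIV"
    unfolding powr_def by (auto intro!: holomorphic_intros)
  have hyp: "hypergeometric [- of_real s / 2, - of_real s / 2] [1 / 2] (of_real (k\<^sup>2 / 4)) =
      of_real (eval_fps (fps_hypergeo [- s / 2, - s / 2] [1/2] 1) (k\<^sup>2 / 4))" for s
    using hypergeometric_of_real[of "1/2" "k\<^sup>2 / 4" "- s / 2" "- s / 2"] kk by simp
  show "(\<lambda>s. Gamma (1 / 2 * s + 1 / 2) * (2 powr s / of_real (sqrt pi) * rGamma (1 + s / 2) *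
      hypergeometric [- s / 2, - s / 2] [1 / 2] (of_real (k\<^sup>2 / 4)))) nicely_meromorphic_on UNIV"
  proof (rule nicely_meromorphic_Gamma_mult[OF _ hol])
    fix z :: complex assume "1 / 2 * z + 1 / 2 \<in> \<int>\<^sub>\<le>\<^sub>0"
    then obtain n :: nat where n: "1 / 2 * z + 1 / 2 = - of_nat n"
      by (elim nonpos_Ints_cases')
    then have "z = - 1 - 2 * of_nat n"
      by (simp add: field_simps eq_neg_iff_add_eq_0)
    then have z: "z = of_real (- 1 - 2 * real n)"
      by simp
    have "(1 + z / 2) \<notin> \<int>\<^sub>\<le>\<^sub>0"
    proof
      assume "1 + z / 2 \<in> \<int>\<^sub>\<le>\<^sub>0"
      then obtain m :: nat where "1 + z / 2 = - of_nat m"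
        by (elim nonpos_Ints_cases')
      then have "1 + (- 1 - 2 * real n) / 2 = - real m"
        unfolding z by (simp add: complex_eq_iff)
      then have "1 + 2 * real m = 2 * real n" by (simp add: field_simps)
      then have "real (1 + 2 * m) = real (2 * n)" by simp
      then have "1 + 2 * m = 2 * n" by (simp only: of_nat_eq_iff)
      then show False by presburger
    qed
    \<comment> \<open>The pole is real, so positivity applies, with both upper parameters equal to
      \<open>n + 1/2\<close>.\<close>
    moreover have "hypergeometric [- z / 2, - z / 2] [1 / 2] (of_real (k\<^sup>2 / 4)) \<noteq> 0"
      using eval_fps_hypergeo_square_pos[of "1/2" "k\<^sup>2 / 4" "- (- 1 - 2 * real n) / 2"] kk
      unfolding z hyp of_real_eq_0_iff by simp
    ultimately show "2 powr z / of_real (sqrt pi) * rGamma (1 + z / 2) *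
        hypergeometric [- z / 2, - z / 2] [1 / 2] (of_real (k\<^sup>2 / 4)) \<noteq> 0"
      by (simp add: rGamma_eq_zero_iff)
  qed simp
  show "(\<lambda>s. Gamma (1 / 2 * s + 1 / 2) * (2 powr s / of_real (sqrt pi) * rGamma (1 + s / 2) *
      hypergeometric [- s / 2, - s / 2] [1 / 2] (of_real (k\<^sup>2 / 4)))) holomorphic_on {s. 1 < Re s}"
    by (rule holomorphic_on_mult[OF holomorphic_Gamma' holomorphic_on_subset[OF hol]])
      (auto elim!: nonpos_Ints_cases' simp: complex_eq_iff intro!: holomorphic_intros)
  fix s :: real assume s: "s > 2"
  define S where "S = complex_of_real s"
  define P where "P = (2::complex) powr S"
  define q where "q = complex_of_real (sqrt pi)"
  define h where "h = complex_of_real (eval_fps (fps_hypergeo [- s / 2, - s / 2] [1/2] 1) (k\<^sup>2 / 4))"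
  have q: "q \<noteq> 0" by (simp add: q_def)
  have qq: "complex_of_real pi = q * q"
    unfolding q_def of_real_mult[symmetric] by simp
  have PR: "complex_of_real (2 powr s) = P"
    using powr_of_real[of 2 s] by (simp add: P_def S_def)
  have B: "complex_of_real (Beta ((s + 1) / 2) (1/2)) = Gamma (1 / 2 * S + 1/2) * q * rGamma (1 + S / 2)"
  proof -
    have eq: "(s + 1) / 2 = s / 2 + 1 / 2" "s / 2 + 1 / 2 + 1 / 2 = 1 + s / 2" by simp_all
    show ?thesis
      unfolding Beta_altdef eq Gamma_one_half_real
      by (simp add: S_def q_def flip: Gamma_complex_of_real rGamma_complex_of_real)
  qed
  have "Gamma (1 / 2 * S + 1 / 2) * (P / q * rGamma (1 + S / 2) * h) =
      P * (Gamma (1 / 2 * S + 1/2) * q * rGamma (1 + S / 2)) / (q * q) * h"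
    using q by simp
  also have "\<dots> = of_real (2 powr s * Beta ((s + 1) / 2) (1/2) / pi * eval_fps (fps_hypergeo [- s / 2, - s / 2] [1/2] 1) (k\<^sup>2 / 4))"
    unfolding of_real_mult of_real_divide B qq PR h_def[symmetric] ..
  also have "2 powr s * Beta ((s + 1) / 2) (1/2) / pi * eval_fps (fps_hypergeo [- s / 2, - s / 2] [1/2] 1) (k\<^sup>2 / 4)
      = cos_moment s k"
    unfolding cos_moment_eq_hypergeo[OF s k] using cos_moment_0[of s] s by simp
  finally show "Gamma (1 / 2 * of_real s + 1 / 2) * (2 powr of_real s / of_real (sqrt pi) * rGamma (1 + of_real s / 2) *
      hypergeometric [- of_real s / 2, - of_real s / 2] [1 / 2] (of_real (k\<^sup>2 / 4))) = of_real (cos_moment s k)"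
    unfolding hyp S_def P_def q_def h_def .
qed

text \<open>
  The right-hand side has a single Gamma factor, whose poles are not cancelled by the other factors.
  The identity includes the junk values: at every pole of a Gamma function both sides are \<open>0\<close>.
\<close>
lemma Gamma_square_quotient:
  fixes s :: complex
  shows "4 powr s * (Gamma ((1 + s) / 2))\<^sup>2 / (of_real pi * Gamma (1 + s)) =
     Gamma (1 / 2 * s + 1 / 2) * (2 powr s / of_real (sqrt pi) * rGamma (1 + s / 2))"
proof -
  define a where "a = Gamma ((1 + s) / 2)"
  define P where "P = (2::complex) powr s"
  define q where "q = complex_of_real (sqrt pi)"
  have P: "P \<noteq> 0" and q: "q \<noteq> 0" by (simp_all add: P_def q_def)
  have qq: "complex_of_real pi = q * q"
    unfolding q_def of_real_mult[symmetric] by simp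
  have PP: "4 powr s = P * P"
    using powr_times_real[of 2 2 s] by (simp add: P_def)
  have a': "Gamma (1 / 2 * s + 1 / 2) = a"
    by (simp add: a_def add_divide_distrib add.commute)
  show ?thesis
  proof (cases "a = 0")
    case True
    then show ?thesis
      unfolding a' a_def[symmetric] by simp
  next
    case a: False
    then have n1: "(1 + s) / 2 \<notin> \<int>\<^sub>\<le>\<^sub>0"
      by (simp add: a_def Gamma_eq_zero_iff)
    show ?thesis
    proof (cases "1 + s / 2 \<in> \<int>\<^sub>\<le>\<^sub>0")
      \<comment> \<open>The value 0 is also the true limit: \<open>Gamma ((1 + s) / 2)\<close> is
        finite while \<open>Gamma (1 + s)\<close> in the denominator has a pole.\<close>
      case True
      then obtain m :: nat where "1 + s / 2 = - of_nat m"
        by (elim nonpos_Ints_cases')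
      then have "s / 2 = - of_nat m - 1"
        by (simp add: algebra_simps)
      moreover have "1 + s = 1 + 2 * (s / 2)" by simp
      ultimately have "1 + s = - of_nat (2 * m + 1)"
        by (simp only:) (simp add: algebra_simps)
      then have "1 + s \<in> \<int>\<^sub>\<le>\<^sub>0"
        by (simp only: minus_of_nat_in_nonpos_Ints)
      then have "Gamma (1 + s) = 0" by (simp add: Gamma_eq_zero_iff)
      moreover have "rGamma (1 + s / 2) = 0"
        using True by (simp add: rGamma_eq_zero_iff)
      ultimately show ?thesis by simp
    next
      case False
      define b g where "b = Gamma (1 + s / 2)" and "g = Gamma (1 + s)"
      have b: "b \<noteq> 0" using False by (simp add: b_def Gamma_eq_zero_iff)
      have d: "a * b * P = q * g"
        using Gamma_half_duplication[OF n1 False] P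
        by (simp add: a_def b_def g_def P_def q_def powr_minus)
      have "q * q * g = q * (a * b * P)"
        unfolding d by (rule mult.assoc)
      then have "P * P * a\<^sup>2 / (q * q * g) = P * P * a\<^sup>2 / (q * (a * b * P))"
        by (simp only:)
      also have "\<dots> = a * (P / q * inverse b)"
        using a P b q by (simp add: field_simps power2_eq_square)
      finally show ?thesis
        unfolding a' PP qq rGamma_inverse_Gamma a_def[symmetric] b_def[symmetric] g_def[symmetric]
          P_def[symmetric] q_def[symmetric] .
    qed
  qed
qed

theorem theorem1p1:
  fixes k :: real and s :: complex
  shows "(\<bar>k\<bar> > 2 \<longrightarrow>
            zeta_mahler 1 k s =
              of_real \<bar>k\<bar> powr s * hypergeometric [- s / 2, (1 - s) / 2] [1] (of_real (4 / k\<^sup>2))) \<and>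
         (\<bar>k\<bar> = 2 \<longrightarrow>
            zeta_mahler 1 k s =
              2 powr s * Gamma (1 / 2 + s) / (Gamma (1 + s / 2) * Gamma ((1 + s) / 2))) \<and>
         (\<bar>k\<bar> < 2 \<longrightarrow>
            zeta_mahler 1 k s =
              4 powr s * (Gamma ((1 + s) / 2))\<^sup>2 / (of_real pi * Gamma (1 + s)) *
              hypergeometric [- s / 2, - s / 2] [1 / 2] (of_real (k\<^sup>2 / 4)))"
proof (intro conjI impI)
  assume k: "\<bar>k\<bar> > 2"
  show "zeta_mahler 1 k s =
      of_real \<bar>k\<bar> powr s * hypergeometric [- s / 2, (1 - s) / 2] [1] (of_real (4 / k\<^sup>2))"
    unfolding zeta_mahler_of_abs_gt_2[OF k] ..
next
  assume k: "\<bar>k\<bar> = 2"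
  have "1 * s + 1 / 2 = 1 / 2 + s" by simp
  then show "zeta_mahler 1 k s = 2 powr s * Gamma (1 / 2 + s) / (Gamma (1 + s / 2) * Gamma ((1 + s) / 2))"
    unfolding zeta_mahler_of_abs_eq_2[OF k]
    by (simp only: rGamma_inverse_Gamma divide_inverse inverse_mult_distrib mult_ac)
next
  assume k: "\<bar>k\<bar> < 2"
  show "zeta_mahler 1 k s =
      4 powr s * (Gamma ((1 + s) / 2))\<^sup>2 / (of_real pi * Gamma (1 + s)) *
      hypergeometric [- s / 2, - s / 2] [1 / 2] (of_real (k\<^sup>2 / 4))"
    unfolding Gamma_square_quotient zeta_mahler_of_abs_lt_2[OF k] mult.assoc ..
qed

end
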